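(* Let $\tau\in(0,\infty)$, let $\mu_1,\mu_2$ be non-negative Borel measures on $\mathbb{R}^+=[0,\infty)$ with $$M:=\mu_1([0,\tau])+\mu_2([0,\infty))\in(0,\infty),$$ and let $f\in C(\mathbb{R}^+;(0,\infty))$ be locally Lipschitz continuous. Suppose there is a decreasing function $\phi\in C^1((0,\infty);(0,\infty))\cap C([0,\infty);(0,\infty))$ such that $\lim_{x\to\infty}f(x)/\phi(x)=1$. Let $\psi\in C([-\tau,0];(0,\infty))$. Put $F(x)=\int_1^x \frac{du}{f(u)}$ for $x>0$. Then the unique continuous solution $x$ of $$x'(t)=\int_{[0,\tau]}\mu_1(ds)f(x(t-s))+\int_{[0,t]}\mu_2(ds)f(x(t-s)),\quad t>0;\qquad x(t)=\psi(t),\ t\in[-\tau,0],$$ obeys $$\lim_{t\to\infty}x(t)=\infty,\qquad \lim_{t\to\infty}\frac{x(t)}{F^{-1}(Mt)}=1.$$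
   Context: $F$ is strictly increasing; $F^{-1}$ is its inverse function. A solution is a continuous function on $[-\tau,\infty)$, locally absolutely continuous on $[0,\infty)$, equal to $\psi$ on $[-\tau,0]$ and satisfying the differential equation for almost every $t>0$. *)

theory Defs
  imports "HOL-Analysis.Analysis"
begin

definition locally_lipschitz_on :: "real set \<Rightarrow> (real \<Rightarrow> real) \<Rightarrow> bool" where
  "locally_lipschitz_on X f \<longleftrightarrow>
     (\<forall>x\<in>X. \<exists>u>0. \<exists>L. L-lipschitz_on (cball x u \<inter> X) f)"

(* The library's absolutely_continuous is a relation between measures;
   this is the epsilon-delta notion for functions. *)
definition abs_continuous_on_interval :: "real \<Rightarrow> real \<Rightarrow> (real \<Rightarrow> real) \<Rightarrow> bool" where
  "abs_continuous_on_interval a b g \<longleftrightarrow>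
     (\<forall>\<epsilon>>0. \<exists>\<delta>>0. \<forall>(n::nat) (u::nat \<Rightarrow> real) v.
        (\<forall>i<n. a \<le> u i \<and> u i \<le> v i \<and> v i \<le> b) \<and>
        disjoint_family_on (\<lambda>i. {u i<..<v i}) {..<n} \<and>
        (\<Sum>i<n. v i - u i) < \<delta>
        \<longrightarrow> (\<Sum>i<n. \<bar>g (v i) - g (u i)\<bar>) < \<epsilon>)"

definition locally_abs_continuous_on :: "real set \<Rightarrow> (real \<Rightarrow> real) \<Rightarrow> bool" where
  "locally_abs_continuous_on S g \<longleftrightarrow>
     (\<forall>a b. a \<le> b \<and> {a..b} \<subseteq> S \<longrightarrow> abs_continuous_on_interval a b g)"

(* The nonlinearity f is only meaningful on [0, infinity), so a solution is
   required to take its values there.  Values of x below -\<tau> are irrelevant. *)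
definition is_solution ::
  "real \<Rightarrow> real measure \<Rightarrow> real measure \<Rightarrow> (real \<Rightarrow> real) \<Rightarrow> (real \<Rightarrow> real) \<Rightarrow> (real \<Rightarrow> real) \<Rightarrow> bool"
  where
  "is_solution \<tau> \<mu>1 \<mu>2 f \<psi> x \<longleftrightarrow>
     continuous_on {-\<tau>..} x \<and>
     (\<forall>t\<ge>-\<tau>. 0 \<le> x t) \<and>
     locally_abs_continuous_on {0..} x \<and>
     (\<forall>t\<in>{-\<tau>..0}. x t = \<psi> t) \<and>
     (AE t in lborel. t > 0 \<longrightarrow>
        (x has_real_derivative
           (LINT s:{0..\<tau>}|\<mu>1. f (x (t - s))) + (LINT s:{0..t}|\<mu>2. f (x (t - s)))) (at t))"

(* An oriented integral: negative for x < 1. *)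
definition recip_primitive :: "(real \<Rightarrow> real) \<Rightarrow> real \<Rightarrow> real" where
  "recip_primitive f x = (LBINT u=ereal 1..ereal x. 1 / f u)"

end

theory Submission
  imports Defs
begin

text \<open>
  A solution is a fixed point of the integral operator \<open>picard\<close>. On \<open>[0, T]\<close> the values of all
  iterates stay below a bound on which \<open>f\<close> is Lipschitz with some constant \<open>L\<close>, and there
  \<open>picard\<close> halves distances in the norm weighted by \<open>exp (- 2 L M t)\<close>; this gives existence and
  uniqueness. Conversely an absolutely continuous \<open>x\<close> with the right derivative almost everywhere
  is a fixed point because an absolutely continuous function with derivative zero almost everywhere is
  constant. The right-hand side is discontinuous only at atoms of the measures, hence at countably
  many times, so fixed points are differentiable almost everywhere.

  For the asymptotics, integrate the equation and exchange the integrals: with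
  \<open>I t = integral {0..t} (f \<circ> x)\<close>, dominated convergence gives \<open>x \<sim> z\<close> for \<open>z = M I\<close>. Now
  \<open>z' = M f(x)\<close> carries no delay. The function \<open>\<phi>\<close> only enters through the consequence that
  \<open>f v \<le> b f u\<close> for every \<open>b > 1\<close> and all large \<open>u \<le> v\<close>. For \<open>\<kappa> > 1\<close> one has eventually
  \<open>z / \<kappa> \<le> x \<le> \<kappa> z\<close>, so with \<open>b = sqrt \<kappa>\<close> the derivative of \<open>F(z / \<kappa>)\<close> is at most
  \<open>M / b < M\<close> and that of \<open>F(\<kappa> z)\<close> is at least \<open>M b > M\<close>. Hence eventually
  \<open>z / \<kappa> \<le> F\<^sup>-\<^sup>1(M t) \<le> \<kappa> z\<close>.
\<close>

subsection \<open>Absolutely continuous functions\<close>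

lemma abs_continuous_on_intervalD:
  assumes "abs_continuous_on_interval a b g" "\<epsilon> > 0"
  obtains \<delta> where "\<delta> > 0"
    "\<And>(n::nat) u v. (\<And>i. i < n \<Longrightarrow> a \<le> u i \<and> u i \<le> v i \<and> v i \<le> b) \<Longrightarrow>
        disjoint_family_on (\<lambda>i. {u i<..<v i}) {..<n} \<Longrightarrow>
        (\<Sum>i<n. v i - u i) < \<delta> \<Longrightarrow> (\<Sum>i<n. \<bar>g (v i) - g (u i)\<bar>) < \<epsilon>"
  using assms unfolding abs_continuous_on_interval_def by meson

text \<open>The form in which absolute continuity meets part of a tagged division: enumerating
  \<open>p\<close> and passing to endpoints turns disjoint interiors into disjoint open intervals.
  The tag \<open>z \<in> k\<close> keeps every \<open>k\<close> nonempty, so that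
  \<open>Inf k\<close> and \<open>Sup k\<close> are its endpoints.\<close>

lemma abs_continuous_on_interval_division:
  assumes "abs_continuous_on_interval a b g" "\<epsilon> > 0"
  obtains \<delta> where "\<delta> > 0"
    "\<And>p. finite p \<Longrightarrow> 
        (\<And>z k. (z, k) \<in> p \<Longrightarrow> k \<subseteq> {a..b} \<and> z \<in> k \<and> (\<exists>c d. k = {c..d})) \<Longrightarrow>
        (\<And>z k z' k'. (z, k) \<in> p \<Longrightarrow> (z', k') \<in> p \<Longrightarrow> (z, k) \<noteq> (z', k') \<Longrightarrow> interior k \<inter> interior k' = {}) \<Longrightarrow>
        (\<Sum>(z, k)\<in>p. Sup k - Inf k) < \<delta> \<Longrightarrow>
        (\<Sum>(z, k)\<in>p. \<bar>g (Sup k) - g (Inf k)\<bar>) < \<epsilon>"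
proof -
  obtain \<delta> where \<delta>: "\<delta> > 0"
    "\<And>(n::nat) u v. (\<And>i. i < n \<Longrightarrow> a \<le> u i \<and> u i \<le> v i \<and> v i \<le> b) \<Longrightarrow>
        disjoint_family_on (\<lambda>i. {u i<..<v i}) {..<n} \<Longrightarrow>
        (\<Sum>i<n. v i - u i) < \<delta> \<Longrightarrow> (\<Sum>i<n. \<bar>g (v i) - g (u i)\<bar>) < \<epsilon>"
    using abs_continuous_on_intervalD[OF assms] by blast
  have "(\<Sum>(z, k)\<in>p. \<bar>g (Sup k) - g (Inf k)\<bar>) < \<epsilon>"
    if fin: "finite p"
      and intv: "\<And>z k. (z, k) \<in> p \<Longrightarrow> k \<subseteq> {a..b} \<and> z \<in> k \<and> (\<exists>c d. k = {c..d})"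
      and disj: "\<And>z k z' k'. (z, k) \<in> p \<Longrightarrow> (z', k') \<in> p \<Longrightarrow> (z, k) \<noteq> (z', k') \<Longrightarrow> interior k \<inter> interior k' = {}"
      and small: "(\<Sum>(z, k)\<in>p. Sup k - Inf k) < \<delta>" for p :: "(real \<times> real set) set"
  proof -
    obtain h where h: "bij_betw h {..<card p} p"
      using ex_bij_betw_nat_finite[OF fin] by (auto simp: atLeast0LessThan)
    define u where "u i = Inf (snd (h i))" for i
    define v where "v i = Sup (snd (h i))" for i
    have hp: "(fst (h i), snd (h i)) \<in> p" if i: "i < card p" for i
      using h i by (auto simp: bij_betw_def)
    have k: "snd (h i) = {u i..v i} \<and> a \<le> u i \<and> u i \<le> v i \<and> v i \<le> b" if i: "i < card p" for i
    proof -
      obtain c d where cd: "snd (h i) = {c..d}" "c \<le> d" "{c..d} \<subseteq> {a..b}"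
        using intv[OF hp[OF i]] by auto
      thus ?thesis by (auto simp: u_def v_def)
    qed
    have "disjoint_family_on (\<lambda>i. {u i<..<v i}) {..<card p}"
      unfolding disjoint_family_on_def
    proof (intro ballI impI)
      fix i j assume ij: "i \<in> {..<card p}" "j \<in> {..<card p}" "i \<noteq> j"
      have "h i \<noteq> h j" using ij h by (auto simp: bij_betw_def inj_on_def)
      hence "interior (snd (h i)) \<inter> interior (snd (h j)) = {}"
        using disj[OF hp hp, of i j] ij by (auto simp: prod_eq_iff)
      moreover have "interior (snd (h i)) = {u i<..<v i}" "interior (snd (h j)) = {u j<..<v j}"
        using k[of i] k[of j] ij by auto
      ultimately show "{u i<..<v i} \<inter> {u j<..<v j} = {}" by simp
    qed
    moreover have "(\<Sum>(z, k)\<in>p. Sup k - Inf k) = (\<Sum>i<card p. v i - u i)"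
      unfolding sum.reindex_bij_betw[OF h, symmetric] by (simp add: case_prod_beta u_def v_def)
    moreover have "(\<Sum>(z, k)\<in>p. \<bar>g (Sup k) - g (Inf k)\<bar>) = (\<Sum>i<card p. \<bar>g (v i) - g (u i)\<bar>)"
      unfolding sum.reindex_bij_betw[OF h, symmetric] by (simp add: case_prod_beta u_def v_def)
    ultimately show ?thesis using \<delta>(2)[of "card p" u v] k small by simp
  qed
  with \<delta>(1) show ?thesis by (rule that)
qed

text \<open>
  The increment of \<open>g\<close> telescopes over a fine tagged division: intervals tagged where the derivative
  vanishes contribute little by the gauge, those tagged in the null set by absolute continuity.
\<close>
lemma abs_continuous_zero_derivative_imp_eq:
  assumes "a \<le> b" and ac: "abs_continuous_on_interval a b g"
    and deriv: "AE t in lborel. a < t \<and> t < b \<longrightarrow> (g has_real_derivative 0) (at t)"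
  shows "g a = g b"
proof -
  have bound: "\<bar>g b - g a\<bar> \<le> \<epsilon> * (b - a) + \<epsilon>" if \<epsilon>: "\<epsilon> > 0" for \<epsilon>
  proof -
    obtain \<delta> where \<delta>: "\<delta> > 0"
      "\<And>p. finite p \<Longrightarrow> 
        (\<And>z k. (z, k) \<in> p \<Longrightarrow> k \<subseteq> {a..b} \<and> z \<in> k \<and> (\<exists>c d. k = {c..d})) \<Longrightarrow>
        (\<And>z k z' k'. (z, k) \<in> p \<Longrightarrow> (z', k') \<in> p \<Longrightarrow> (z, k) \<noteq> (z', k') \<Longrightarrow> interior k \<inter> interior k' = {}) \<Longrightarrow>
        (\<Sum>(z, k)\<in>p. Sup k - Inf k) < \<delta> \<Longrightarrow>
        (\<Sum>(z, k)\<in>p. \<bar>g (Sup k) - g (Inf k)\<bar>) < \<epsilon>"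
      using abs_continuous_on_interval_division[OF ac \<epsilon>] by blast
    obtain N0 where N0: "N0 \<in> null_sets lborel"
      "{t. \<not> (a < t \<and> t < b \<longrightarrow> (g has_real_derivative 0) (at t))} \<subseteq> N0"
      using deriv by (auto elim!: AE_E simp: null_sets_def)
    \<comment> \<open>The derivative is known only inside the open interval, so both endpoints join
      the exceptional set.\<close>
    define N where "N = N0 \<union> {a, b}"
    have N: "N \<in> null_sets lborel"
      unfolding N_def using N0(1) finite_imp_null_set_lborel[of "{a, b}"] null_sets.Un by blast
    \<comment> \<open>Outer regularity gives an open cover of the null set of measure below
      \<delta>. Taking it as the gauge at points of \<open>N\<close> forces intervals tagged there
      into \<open>U\<close>.\<close>
    obtain U where U: "open U" "N \<subseteq> U" "emeasure lborel (U - N) < \<delta>"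
      using outer_regular_lborel[of N \<delta>] N \<delta>(1) by (metis null_setsD2 sets_lborel)
    have eU: "emeasure lborel U < \<delta>"
      using U N emeasure_Un_null_set[of "U - N" lborel N]
      by (metis Diff_partition Un_commute borel_open null_setsD2 sets.Diff sets_lborel)
    have diffle: "\<exists>r>0. \<forall>y. \<bar>y - t\<bar> < r \<longrightarrow> \<bar>g y - g t\<bar> \<le> \<epsilon> * \<bar>y - t\<bar>" if t: "t \<in> {a..b} - N" for t
    proof -
      have "t \<notin> N0" "a < t" "t < b" using t by (auto simp: N_def)
      hence "(g has_real_derivative 0) (at t)" using N0(2) by blast
      hence "(g has_derivative (\<lambda>_. 0)) (at t)" by (simp add: has_field_derivative_def lambda_zero[symmetric])
      then obtain r where r: "r > 0" "\<And>y. norm (y - t) < r \<Longrightarrow> norm (g y - g t - 0) \<le> \<epsilon> * norm (y - t)"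
        using \<epsilon> unfolding has_derivative_at_alt by blast
      thus ?thesis by (intro exI[of _ r]) auto
    qed
    then obtain r where r: "\<And>t. t \<in> {a..b} - N \<Longrightarrow> r t > 0 \<and> (\<forall>y. \<bar>y - t\<bar> < r t \<longrightarrow> \<bar>g y - g t\<bar> \<le> \<epsilon> * \<bar>y - t\<bar>)"
      by metis
    \<comment> \<open>The radius 1 outside \<open>{a..b}\<close> is a filler: a gauge is defined on
      the whole line, but all tags lie in \<open>{a..b}\<close>.\<close>
    define \<gamma> where "\<gamma> t = (if t \<in> N then U else ball t (if t \<in> {a..b} then r t else 1))" for t
    have "gauge \<gamma>"
      unfolding gauge_def \<gamma>_def using U r by auto
    then obtain p where p: "p tagged_division_of {a..b}" "\<gamma> fine p"
      using fine_division_exists_real by blast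
    have fin: "finite p" using p(1) by blast
    have pk: "k \<subseteq> {a..b} \<and> z \<in> k \<and> (\<exists>c d. k = {c..d})" if "(z, k) \<in> p" for z k
      using tagged_division_ofD(2,3,4)[OF p(1) that] by (auto simp: cbox_interval)
    have pd: "interior k \<inter> interior k' = {}" if "(z, k) \<in> p" "(z', k') \<in> p" "(z, k) \<noteq> (z', k')" for z k z' k'
      using tagged_division_ofD(5)[OF p(1) that] .
    define p1 where "p1 = {zk \<in> p. fst zk \<in> N}"
    have p12: "p = p1 \<union> (p - p1)" "p1 \<inter> (p - p1) = {}" "p1 \<subseteq> p" by (auto simp: p1_def)
    have fin1: "finite p1" using fin p12 finite_subset by blast
    have small: "(\<Sum>(z, k)\<in>p1. Sup k - Inf k) < \<delta>"
    proof -
      have kk: "interior k = {Inf k<..<Sup k} \<and> Inf k \<le> Sup k \<and> k \<subseteq> U" if "(z, k) \<in> p1" for z k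
      proof -
        have zk: "(z, k) \<in> p" "z \<in> N" using that by (auto simp: p1_def)
        obtain c d where "k = {c..d}" "z \<in> k" using pk[OF zk(1)] by auto
        moreover have "k \<subseteq> U" using fineD[OF p(2) zk(1)] zk(2) by (simp add: \<gamma>_def)
        ultimately show ?thesis by auto
      qed
      have dis: "disjoint_family_on (\<lambda>zk. interior (snd zk)) p1"
        unfolding disjoint_family_on_def using pd p12(3) by fastforce
      \<comment> \<open>Interiors are disjoint and have the same length as the intervals, so the
        total length is the measure of a subset of \<open>U\<close>.\<close>
      have "ennreal (\<Sum>(z, k)\<in>p1. Sup k - Inf k) = (\<Sum>zk\<in>p1. emeasure lborel (interior (snd zk)))"
        using kk by (subst sum_ennreal[symmetric]) (auto intro!: sum.cong simp: case_prod_beta)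
      also have "\<dots> = emeasure lborel (\<Union>zk\<in>p1. interior (snd zk))"
        using dis fin1 by (intro sum_emeasure) auto
      also have "\<dots> \<le> emeasure lborel U"
      proof (rule emeasure_mono)
        show "(\<Union>zk\<in>p1. interior (snd zk)) \<subseteq> U"
        proof
          fix y assume "y \<in> (\<Union>zk\<in>p1. interior (snd zk))"
          then obtain z k where "(z, k) \<in> p1" "y \<in> interior k" by auto
          thus "y \<in> U" using kk interior_subset[of k] by blast
        qed
      qed (use U in simp)
      also note eU
      finally have "ennreal (\<Sum>(z, k)\<in>p1. Sup k - Inf k) < ennreal \<delta>" .
      moreover have "(\<Sum>(z, k)\<in>p1. Sup k - Inf k) \<ge> 0" using kk by (intro sum_nonneg) auto
      ultimately show ?thesis by (simp add: ennreal_less_iff)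
    qed
    have b1: "(\<Sum>(z, k)\<in>p1. \<bar>g (Sup k) - g (Inf k)\<bar>) < \<epsilon>"
      using p12(3) by (intro \<delta>(2) fin1 small pk pd) auto
    have b2: "(\<Sum>(z, k)\<in>p - p1. \<bar>g (Sup k) - g (Inf k)\<bar>) \<le> (\<Sum>(z, k)\<in>p - p1. \<epsilon> * (Sup k - Inf k))"
    proof (intro sum_mono, clarify)
      fix z k assume zk: "(z, k) \<in> p" "(z, k) \<notin> p1"
      obtain c d where cd: "k = {c..d}" "c \<le> z" "z \<le> d" "a \<le> c" "d \<le> b" using pk[OF zk(1)] by auto
      have z: "z \<in> {a..b} - N" using zk cd by (auto simp: p1_def)
      have "k \<subseteq> ball z (r z)" using fineD[OF p(2) zk(1)] z by (simp add: \<gamma>_def)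
      moreover have "c \<in> k" "d \<in> k" using cd by auto
      ultimately have "\<bar>c - z\<bar> < r z" "\<bar>d - z\<bar> < r z" by (auto simp: dist_real_def abs_minus_commute)
      hence "\<bar>g c - g z\<bar> \<le> \<epsilon> * \<bar>c - z\<bar>" "\<bar>g d - g z\<bar> \<le> \<epsilon> * \<bar>d - z\<bar>" using r[OF z] by auto
      \<comment> \<open>Splitting at the tag \<open>z\<close> applies the derivative estimate to
        each half; the two bounds add up to \<epsilon> times the length.\<close>
      hence "\<bar>g d - g c\<bar> \<le> \<epsilon> * (z - c) + \<epsilon> * (d - z)" using cd by (auto simp: abs_if split: if_splits)
      thus "\<bar>g (Sup k) - g (Inf k)\<bar> \<le> \<epsilon> * (Sup k - Inf k)" using cd by (simp add: algebra_simps)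
    qed
    also have "\<dots> \<le> (\<Sum>(z, k)\<in>p. \<epsilon> * (Sup k - Inf k))"
    proof (rule sum_mono2[OF fin])
      fix zk assume "zk \<in> p - (p - p1)"
      then obtain z k where zk: "zk = (z, k)" "(z, k) \<in> p" by (cases zk) auto
      then obtain c d where "k = {c..d}" "c \<le> d" using pk[of z k] by auto
      thus "0 \<le> (case zk of (z, k) \<Rightarrow> \<epsilon> * (Sup k - Inf k))" using \<epsilon> zk by simp
    qed auto
    also have "\<dots> = \<epsilon> * (b - a)"
      using additive_tagged_division_1[OF \<open>a \<le> b\<close> p(1), of "\<lambda>x. x"]
      by (simp add: sum_distrib_left[symmetric] case_prod_beta)
    finally have b2: "(\<Sum>(z, k)\<in>p - p1. \<bar>g (Sup k) - g (Inf k)\<bar>) \<le> \<epsilon> * (b - a)" .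
    have "\<bar>g b - g a\<bar> = \<bar>\<Sum>(z, k)\<in>p. g (Sup k) - g (Inf k)\<bar>"
      using additive_tagged_division_1[OF \<open>a \<le> b\<close> p(1), of g] by simp
    also have "\<dots> \<le> (\<Sum>(z, k)\<in>p. \<bar>g (Sup k) - g (Inf k)\<bar>)"
      by (rule order_trans[OF sum_abs]) (simp add: case_prod_beta)
    also have "\<dots> = (\<Sum>(z, k)\<in>p1. \<bar>g (Sup k) - g (Inf k)\<bar>) + (\<Sum>(z, k)\<in>p - p1. \<bar>g (Sup k) - g (Inf k)\<bar>)"
      using sum.subset_diff[OF p12(3) fin, of "\<lambda>(z, k). \<bar>g (Sup k) - g (Inf k)\<bar>"] by simp
    finally show ?thesis using b1 b2 by simp
  qed
  have "\<bar>g b - g a\<bar> \<le> 0"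
  proof (rule field_le_epsilon)
    fix e :: real assume e: "e > 0"
    \<comment> \<open>This value of \<epsilon> makes the bound equal to \<open>e\<close>; the added
      1 keeps the denominator positive when \<open>a = b\<close>.\<close>
    have "\<bar>g b - g a\<bar> \<le> (e / (b - a + 1)) * (b - a) + e / (b - a + 1)"
      using e \<open>a \<le> b\<close> by (intro bound) simp
    also have "\<dots> = e" using \<open>a \<le> b\<close> by (simp add: divide_simps) (simp add: algebra_simps)
    finally show "\<bar>g b - g a\<bar> \<le> 0 + e" by simp
  qed
  thus ?thesis by simp
qed

lemma lipschitz_imp_abs_continuous:
  assumes "L-lipschitz_on {a..b} g"
  shows "abs_continuous_on_interval a b g"
  unfolding abs_continuous_on_interval_def
proof (intro allI impI)
  fix \<epsilon> :: real assume "\<epsilon> > 0"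
  have L: "0 \<le> L" using assms by (rule lipschitz_on_nonneg)
  show "\<exists>\<delta>>0. \<forall>(n::nat) u v. (\<forall>i<n. a \<le> u i \<and> u i \<le> v i \<and> v i \<le> b) \<and>
      disjoint_family_on (\<lambda>i. {u i<..<v i}) {..<n} \<and> (\<Sum>i<n. v i - u i) < \<delta> \<longrightarrow>
      (\<Sum>i<n. \<bar>g (v i) - g (u i)\<bar>) < \<epsilon>"
  \<comment> \<open>With \<open>L + 1\<close> in place of \<open>L\<close> the quotient makes sense
    for \<open>L = 0\<close>, and the final inequality is strict.\<close>
  proof (rule exI[of _ "\<epsilon> / (L + 1)"], intro conjI allI impI)
    fix n :: nat and u v :: "nat \<Rightarrow> real"
    assume uv: "(\<forall>i<n. a \<le> u i \<and> u i \<le> v i \<and> v i \<le> b) \<and>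
      disjoint_family_on (\<lambda>i. {u i<..<v i}) {..<n} \<and> (\<Sum>i<n. v i - u i) < \<epsilon> / (L + 1)"
    have "(\<Sum>i<n. \<bar>g (v i) - g (u i)\<bar>) \<le> (\<Sum>i<n. L * (v i - u i))"
    proof (rule sum_mono)
      fix i assume "i \<in> {..<n}"
      hence "a \<le> u i" "u i \<le> v i" "v i \<le> b" using uv by auto
      thus "\<bar>g (v i) - g (u i)\<bar> \<le> L * (v i - u i)"
        using lipschitz_onD[OF assms, of "v i" "u i"] by (simp add: dist_real_def)
    qed
    also have "\<dots> = L * (\<Sum>i<n. v i - u i)" by (simp add: sum_distrib_left)
    also have "\<dots> \<le> L * (\<epsilon> / (L + 1))" using uv L by (intro mult_left_mono) auto
    also have "\<dots> < \<epsilon>" using L \<open>\<epsilon> > 0\<close> by (simp add: field_simps)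
    finally show "(\<Sum>i<n. \<bar>g (v i) - g (u i)\<bar>) < \<epsilon>" .
  qed (use L \<open>\<epsilon> > 0\<close> in simp)
qed

lemma abs_continuous_on_interval_diff:
  assumes "abs_continuous_on_interval a b g" "abs_continuous_on_interval a b h"
  shows "abs_continuous_on_interval a b (\<lambda>t. g t - h t)"
  unfolding abs_continuous_on_interval_def
proof (intro allI impI)
  fix \<epsilon> :: real assume "\<epsilon> > 0"
  hence \<epsilon>: "\<epsilon> / 2 > 0" by simp
  obtain \<delta>1 where \<delta>1: "\<delta>1 > 0"
    "\<And>(n::nat) u v. (\<And>i. i < n \<Longrightarrow> a \<le> u i \<and> u i \<le> v i \<and> v i \<le> b) \<Longrightarrow>
        disjoint_family_on (\<lambda>i. {u i<..<v i}) {..<n} \<Longrightarrow>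
        (\<Sum>i<n. v i - u i) < \<delta>1 \<Longrightarrow> (\<Sum>i<n. \<bar>g (v i) - g (u i)\<bar>) < \<epsilon> / 2"
    using abs_continuous_on_intervalD[OF assms(1) \<epsilon>] by blast
  obtain \<delta>2 where \<delta>2: "\<delta>2 > 0"
    "\<And>(n::nat) u v. (\<And>i. i < n \<Longrightarrow> a \<le> u i \<and> u i \<le> v i \<and> v i \<le> b) \<Longrightarrow>
        disjoint_family_on (\<lambda>i. {u i<..<v i}) {..<n} \<Longrightarrow>
        (\<Sum>i<n. v i - u i) < \<delta>2 \<Longrightarrow> (\<Sum>i<n. \<bar>h (v i) - h (u i)\<bar>) < \<epsilon> / 2"
    using abs_continuous_on_intervalD[OF assms(2) \<epsilon>] by blast
  show "\<exists>\<delta>>0. \<forall>(n::nat) u v. (\<forall>i<n. a \<le> u i \<and> u i \<le> v i \<and> v i \<le> b) \<and>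
      disjoint_family_on (\<lambda>i. {u i<..<v i}) {..<n} \<and> (\<Sum>i<n. v i - u i) < \<delta> \<longrightarrow>
      (\<Sum>i<n. \<bar>(g (v i) - h (v i)) - (g (u i) - h (u i))\<bar>) < \<epsilon>"
  proof (rule exI[of _ "min \<delta>1 \<delta>2"], intro conjI allI impI)
    fix n :: nat and u v :: "nat \<Rightarrow> real"
    assume uv: "(\<forall>i<n. a \<le> u i \<and> u i \<le> v i \<and> v i \<le> b) \<and>
      disjoint_family_on (\<lambda>i. {u i<..<v i}) {..<n} \<and> (\<Sum>i<n. v i - u i) < min \<delta>1 \<delta>2"
    have "(\<Sum>i<n. \<bar>(g (v i) - h (v i)) - (g (u i) - h (u i))\<bar>)
        \<le> (\<Sum>i<n. \<bar>g (v i) - g (u i)\<bar> + \<bar>h (v i) - h (u i)\<bar>)"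
      by (intro sum_mono) linarith
    also have "\<dots> = (\<Sum>i<n. \<bar>g (v i) - g (u i)\<bar>) + (\<Sum>i<n. \<bar>h (v i) - h (u i)\<bar>)"
      by (rule sum.distrib)
    also have "\<dots> < \<epsilon> / 2 + \<epsilon> / 2"
      using uv by (intro add_strict_mono \<delta>1(2) \<delta>2(2)) auto
    finally show "(\<Sum>i<n. \<bar>(g (v i) - h (v i)) - (g (u i) - h (u i))\<bar>) < \<epsilon>" by simp
  qed (use \<delta>1 \<delta>2 in simp)
qed

lemma abs_continuous_on_interval_cong:
  assumes "abs_continuous_on_interval a b g" "\<And>t. a \<le> t \<Longrightarrow> t \<le> b \<Longrightarrow> h t = g t"
  shows "abs_continuous_on_interval a b h"
  unfolding abs_continuous_on_interval_def
proof (intro allI impI)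
  fix \<epsilon> :: real assume "\<epsilon> > 0"
  from abs_continuous_on_intervalD[OF assms(1) this] obtain \<delta> where \<delta>: "\<delta> > 0"
    "\<And>(n::nat) u v. (\<And>i. i < n \<Longrightarrow> a \<le> u i \<and> u i \<le> v i \<and> v i \<le> b) \<Longrightarrow>
        disjoint_family_on (\<lambda>i. {u i<..<v i}) {..<n} \<Longrightarrow>
        (\<Sum>i<n. v i - u i) < \<delta> \<Longrightarrow> (\<Sum>i<n. \<bar>g (v i) - g (u i)\<bar>) < \<epsilon>"
    by blast
  show "\<exists>\<delta>>0. \<forall>(n::nat) u v. (\<forall>i<n. a \<le> u i \<and> u i \<le> v i \<and> v i \<le> b) \<and>
      disjoint_family_on (\<lambda>i. {u i<..<v i}) {..<n} \<and> (\<Sum>i<n. v i - u i) < \<delta> \<longrightarrow>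
      (\<Sum>i<n. \<bar>h (v i) - h (u i)\<bar>) < \<epsilon>"
  proof (intro exI[of _ \<delta>] conjI allI impI \<delta>(1))
    fix n :: nat and u v :: "nat \<Rightarrow> real"
    assume uv: "(\<forall>i<n. a \<le> u i \<and> u i \<le> v i \<and> v i \<le> b) \<and>
      disjoint_family_on (\<lambda>i. {u i<..<v i}) {..<n} \<and> (\<Sum>i<n. v i - u i) < \<delta>"
    have "(\<Sum>i<n. \<bar>h (v i) - h (u i)\<bar>) = (\<Sum>i<n. \<bar>g (v i) - g (u i)\<bar>)"
    proof (rule sum.cong[OF refl])
      fix i assume "i \<in> {..<n}"
      hence "a \<le> u i \<and> u i \<le> v i \<and> v i \<le> b" using uv by simp
      hence "h (v i) = g (v i)" "h (u i) = g (u i)" using assms(2) by auto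
      thus "\<bar>h (v i) - h (u i)\<bar> = \<bar>g (v i) - g (u i)\<bar>" by simp
    qed
    also have "\<dots> < \<epsilon>" using uv by (intro \<delta>(2)) auto
    finally show "(\<Sum>i<n. \<bar>h (v i) - h (u i)\<bar>) < \<epsilon>" .
  qed
qed

subsection \<open>Averaging over a finite measure of delays\<close>

lemma bounded_borel_set_integrable:
  fixes g :: "real \<Rightarrow> real"
  assumes [measurable]: "g \<in> borel_measurable borel" and "\<And>v. \<bar>g v\<bar> \<le> K"
  shows "set_integrable lborel {a..b} g"
  unfolding set_integrable_def
  by (rule integrableI_bounded_set_indicator[where B = K])
    (use assms(2) in \<open>auto simp: emeasure_lborel_Icc_eq\<close>)

lemmas bounded_borel_integrable_on =
  set_borel_integral_eq_integral(1)[OF bounded_borel_set_integrable]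

lemmas integral_eq_set_lebesgue =
  set_borel_integral_eq_integral(2)[OF bounded_borel_set_integrable, symmetric]

lemma abs_integral_le_bound:
  fixes g :: "real \<Rightarrow> real"
  assumes "a \<le> b" "g \<in> borel_measurable borel" "\<And>v. \<bar>g v\<bar> \<le> K"
  shows "\<bar>integral {a..b} g\<bar> \<le> K * (b - a)"
proof -
  have "norm (integral {a..b} g) \<le> integral {a..b} (\<lambda>_. K)"
    using assms by (intro integral_norm_bound_integral bounded_borel_integrable_on) auto
  thus ?thesis using assms(1) by (simp add: mult.commute)
qed

text \<open>Measurability of the identity replaces a fixed sigma-algebra, so that restrictions of
  measures living on \<open>{0..}\<close> are instances. A point of the space is itself the
  delay.\<close>

locale delay_measure = finite_measure \<nu> for \<nu> :: "real measure" +
  assumes id_measurable [measurable]: "(\<lambda>s. s) \<in> borel_measurable \<nu>"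
    and delay_nonneg: "s \<in> space \<nu> \<Longrightarrow> 0 \<le> s"
begin

text \<open>The convolution of \<open>g\<close> with the measure \<nu>.\<close>

definition delayed :: "(real \<Rightarrow> real) \<Rightarrow> real \<Rightarrow> real" where
  "delayed g u = (LINT s|\<nu>. g (u - s))"

abbreviation mass :: real where "mass \<equiv> measure \<nu> (space \<nu>)"

lemma integrable_shift:
  fixes g :: "real \<Rightarrow> real"
  assumes [measurable]: "g \<in> borel_measurable borel" and "\<And>v. \<bar>g v\<bar> \<le> K"
  shows "integrable \<nu> (\<lambda>s. g (u - s))"
  by (rule integrable_const_bound[where B = K]) (use assms(2) in auto)

lemma borel_measurable_delayed [measurable (raw)]:
  assumes [measurable]: "g \<in> borel_measurable borel"
  shows "delayed g \<in> borel_measurable borel"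
proof -
  have "(\<lambda>u. LINT s|\<nu>. g (u - s)) \<in> borel_measurable borel"
    by (rule borel_measurable_lebesgue_integral) measurable
  thus ?thesis by (simp add: delayed_def[abs_def])
qed

text \<open>Delays are nonnegative, so the average at \<open>u\<close> sees only values at times
  \<open>v \<le> u\<close>. This causality lets the contraction work on bounded time
  intervals.\<close>

lemma delayed_diff_le:
  assumes [measurable]: "g \<in> borel_measurable borel" "h \<in> borel_measurable borel"
    and "\<And>v. \<bar>g v\<bar> \<le> K" "\<And>v. \<bar>h v\<bar> \<le> K"
    and le: "\<And>v. v \<le> u \<Longrightarrow> \<bar>g v - h v\<bar> \<le> c"
  shows "\<bar>delayed g u - delayed h u\<bar> \<le> c * mass"
proof -
  note int = integrable_shift[OF assms(1,3)] integrable_shift[OF assms(2,4)]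
  have "delayed g u - delayed h u = (LINT s|\<nu>. g (u - s) - h (u - s))"
    unfolding delayed_def using int by simp
  also have "\<bar>\<dots>\<bar> \<le> (LINT s|\<nu>. \<bar>g (u - s) - h (u - s)\<bar>)"
    by (rule integral_abs_bound)
  also have "\<dots> \<le> (LINT s|\<nu>. c)"
    using int by (intro integral_mono) (auto intro!: le simp: delay_nonneg)
  finally show ?thesis by (simp add: mult.commute)
qed

lemma abs_delayed_le:
  assumes [measurable]: "g \<in> borel_measurable borel" and "\<And>v. \<bar>g v\<bar> \<le> K"
  shows "\<bar>delayed g u\<bar> \<le> K * mass"
  using delayed_diff_le[of g "\<lambda>_. 0" K u K] assms order_trans[OF abs_ge_zero assms(2)]
  by (simp add: delayed_def)

lemma delayed_nonneg: "(\<And>v. 0 \<le> g v) \<Longrightarrow> 0 \<le> delayed g u"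
  by (simp add: delayed_def)

text \<open>As a function of \<open>u\<close>, the integrand \<open>g (u - s)\<close> can be
  discontinuous only for \<open>s = u\<close>. By dominated convergence the average is therefore
  continuous at every \<open>u\<close> that is not an atom, and a finite measure has countably many
  atoms. The exception at 0 leaves room for the jump of a truncated function.\<close>

lemma delayed_isCont_countable:
  assumes [measurable]: "g \<in> borel_measurable borel" and bd: "\<And>v. \<bar>g v\<bar> \<le> K"
    and cont: "\<And>v. v \<noteq> 0 \<Longrightarrow> isCont g v"
  shows "countable {u. \<not> isCont (delayed g) u}"
proof -
  \<comment> \<open>The image measure lives on the Borel sets of the line, where singletons are
    measurable and countability of the atoms can be quoted.\<close>
  let ?D = "distr \<nu> borel (\<lambda>s. s)"
  interpret D: finite_measure ?D by (rule finite_measure_distr) measurable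
  have "isCont (delayed g) u" if u: "measure ?D {u} = 0" for u
  proof -
    have "emeasure ?D {u} = 0" using u by (simp add: D.emeasure_eq_measure)
    hence "AE s in ?D. s \<noteq> u" by (intro AE_I[where N = "{u}"]) auto
    hence ae: "AE s in \<nu>. s \<noteq> u" by (subst (asm) AE_distr_iff) auto
    show ?thesis
      unfolding continuous_at_sequentially comp_def delayed_def
    proof (intro allI impI)
      fix X :: "nat \<Rightarrow> real" assume X: "X \<longlonglongrightarrow> u"
      show "(\<lambda>n. LINT s|\<nu>. g (X n - s)) \<longlonglongrightarrow> (LINT s|\<nu>. g (u - s))"
      proof (rule integral_dominated_convergence[where w = "\<lambda>_. K"])
        show "AE s in \<nu>. (\<lambda>n. g (X n - s)) \<longlonglongrightarrow> g (u - s)"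
          using ae
        proof eventually_elim
          fix s assume "s \<noteq> u"
          thus "(\<lambda>n. g (X n - s)) \<longlonglongrightarrow> g (u - s)"
            by (intro isCont_tendsto_compose[OF cont] tendsto_intros X) auto
        qed
      qed (use bd in auto)
    qed
  qed
  hence "{u. \<not> isCont (delayed g) u} \<subseteq> {u. measure ?D {u} \<noteq> 0}" by blast
  thus ?thesis using D.countable_support countable_subset by blast
qed

section \<open>Time integrals of averaged functions\<close>

lemma integral_delayed:
  assumes [measurable]: "g \<in> borel_measurable borel" and bd: "\<And>v. \<bar>g v\<bar> \<le> K"
  shows "integral {a..b} (delayed g) = (LINT s|\<nu>. integral {a..b} (\<lambda>u. g (u - s)))"
proof -
  interpret P: pair_sigma_finite \<nu> lborel ..
  let ?h = "\<lambda>s u. indicator {a..b} u * g (u - s)"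
  \<comment> \<open>The integrand is bounded and vanishes off a set of finite product measure, so
    Fubini applies.\<close>
  have int: "integrable (\<nu> \<Otimes>\<^sub>M lborel) (case_prod ?h)"
  proof (rule integrableI_bounded_set[where A = "space \<nu> \<times> {a..b}" and B = K])
    show "emeasure (\<nu> \<Otimes>\<^sub>M lborel) (space \<nu> \<times> {a..b}) < \<infinity>"
      by (subst lborel.emeasure_pair_measure_Times)
        (auto simp: ennreal_mult_eq_top_iff emeasure_lborel_Icc_eq less_top[symmetric])
    show "AE x in \<nu> \<Otimes>\<^sub>M lborel. x \<in> space \<nu> \<times> {a..b} \<longrightarrow> norm (case_prod ?h x) \<le> K"
      using bd order_trans[OF abs_ge_zero bd] by (auto simp: indicator_def)
    show "AE x in \<nu> \<Otimes>\<^sub>M lborel. x \<notin> space \<nu> \<times> {a..b} \<longrightarrow> case_prod ?h x = 0"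
      by (rule AE_I2) (auto simp: space_pair_measure indicator_def split: if_splits)
  qed measurable
  have "integral {a..b} (delayed g) = (LINT u|lborel. (LINT s|\<nu>. ?h s u))"
    by (subst integral_eq_set_lebesgue[OF _ abs_delayed_le])
      (use bd in \<open>auto simp: set_lebesgue_integral_def delayed_def\<close>)
  also have "\<dots> = (LINT s|\<nu>. (LINT u|lborel. ?h s u))"
    by (rule P.Fubini_integral[OF int])
  also have "\<dots> = (LINT s|\<nu>. integral {a..b} (\<lambda>u. g (u - s)))"
    by (subst integral_eq_set_lebesgue[where K = K])
      (use bd in \<open>auto simp: set_lebesgue_integral_def\<close>)
  finally show ?thesis .
qed

text \<open>The shifted integral is the integral over \<open>{-s..t - s}\<close>. Compared with
  \<open>{0..t}\<close> it can gain at most the piece over \<open>{-s..0}\<close> and lose at most a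
  piece of length \<open>s\<close> at the right end.\<close>

lemma integral_shift_le:
  fixes g :: "real \<Rightarrow> real"
  assumes meas [measurable]: "g \<in> borel_measurable borel" and bd: "\<And>v. \<bar>g v\<bar> \<le> K" and nn: "\<And>v. 0 \<le> g v"
    and "0 \<le> s" "0 \<le> t"
  shows "integral {0..t} (\<lambda>u. g (u - s)) \<le> integral {-s..0} g + integral {0..t} g"
    and "integral {0..t} g - K * s \<le> integral {0..t} (\<lambda>u. g (u - s))"
proof -
  have eq: "integral {0..t} (\<lambda>u. g (u - s)) = integral {-s..t - s} g"
    using integral_shift_Icc_real[of 0 t g "-s"] by (simp add: o_def)
  have "integral {-s..t - s} g \<le> integral {-s..t} g"
    using assms by (intro integral_subset_le bounded_borel_integrable_on) auto
  also have "\<dots> = integral {-s..0} g + integral {0..t} g"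
    using assms by (intro Henstock_Kurzweil_Integration.integral_combine[symmetric] bounded_borel_integrable_on) auto
  finally show "integral {0..t} (\<lambda>u. g (u - s)) \<le> integral {-s..0} g + integral {0..t} g" using eq by simp
  have "integral {0..t} g \<le> integral {-s..t} g"
    using assms by (intro integral_subset_le bounded_borel_integrable_on) auto
  also have "\<dots> = integral {-s..t - s} g + integral {t - s..t} g"
    using assms by (intro Henstock_Kurzweil_Integration.integral_combine[symmetric] bounded_borel_integrable_on) auto
  also have "integral {t - s..t} g \<le> K * s"
    using abs_integral_le_bound[of "t - s" t g K] assms by simp
  finally show "integral {0..t} g - K * s \<le> integral {0..t} (\<lambda>u. g (u - s))" using eq by simp
qed

lemma borel_measurable_integral_shift:
  fixes g :: "real \<Rightarrow> real"
  assumes [measurable]: "g \<in> borel_measurable borel" and bd: "\<And>v. \<bar>g v\<bar> \<le> K"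
  shows "(\<lambda>s. integral {a..b} (\<lambda>u. g (u - s))) \<in> borel_measurable \<nu>"
proof -
  have "(\<lambda>s. LINT u|lborel. indicator {a..b} u * g (u - s)) \<in> borel_measurable \<nu>"
    by (rule lborel.borel_measurable_lebesgue_integral) measurable
  thus ?thesis
    by (subst integral_eq_set_lebesgue[where K = K]) (use bd in \<open>auto simp: set_lebesgue_integral_def\<close>)
qed

text \<open>An estimate available before anything is known about the growth of the integral of
  \<open>g\<close>; \<open>B\<close> absorbs the history reached by the delays.\<close>

lemma integral_delayed_le:
  assumes meas [measurable]: "g \<in> borel_measurable borel" and bd: "\<And>v. \<bar>g v\<bar> \<le> K" and nn: "\<And>v. 0 \<le> g v"
    and B: "\<And>s. s \<in> space \<nu> \<Longrightarrow> integral {-s..0} g \<le> B" and "0 \<le> t"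
  shows "integral {0..t} (delayed g) \<le> (B + integral {0..t} g) * mass"
proof -
  have "integral {0..t} (delayed g) = (LINT s|\<nu>. integral {0..t} (\<lambda>u. g (u - s)))"
    by (rule integral_delayed[OF meas bd])
  also have "\<dots> \<le> (LINT s|\<nu>. B + integral {0..t} g)"
  proof (rule integral_mono)
    show "integrable \<nu> (\<lambda>s. integral {0..t} (\<lambda>u. g (u - s)))"
    proof (rule integrable_const_bound[where B = "K * (t - 0)"])
      show "AE s in \<nu>. norm (integral {0..t} (\<lambda>u. g (u - s))) \<le> K * (t - 0)"
        unfolding real_norm_def
        by (intro AE_I2 abs_integral_le_bound) (use \<open>0 \<le> t\<close> bd in auto)
    qed (rule borel_measurable_integral_shift[OF meas bd])
    fix s assume s: "s \<in> space \<nu>"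
    show "integral {0..t} (\<lambda>u. g (u - s)) \<le> B + integral {0..t} g"
      using integral_shift_le(1)[OF meas bd nn delay_nonneg[OF s] \<open>0 \<le> t\<close>] B[OF s] by linarith
  qed auto
  finally show ?thesis by (simp add: mult.commute)
qed

text \<open>For fixed \<open>s\<close> the shift changes the integral by a bounded amount, which is
  negligible against a divergent integral, so each ratio tends to 1. The lower estimate depends on
  \<open>s\<close>, and no first moment of \<nu> is assumed; hence the limit is taken by dominated
  convergence. This removes the delays from the asymptotics.\<close>

lemma integral_delayed_asymp:
  assumes meas [measurable]: "g \<in> borel_measurable borel" and bd: "\<And>v. \<bar>g v\<bar> \<le> K" and nn: "\<And>v. 0 \<le> g v"
    and B: "\<And>s. s \<in> space \<nu> \<Longrightarrow> integral {-s..0} g \<le> B"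
    and lim: "filterlim (\<lambda>t. integral {0..t} g) at_top at_top"
  shows "((\<lambda>t. integral {0..t} (delayed g) / integral {0..t} g) \<longlongrightarrow> mass) at_top"
proof -
  let ?I = "\<lambda>t. integral {0..t} g"
  let ?J = "\<lambda>t s. integral {0..t} (\<lambda>u. g (u - s))"
  note measJ = borel_measurable_integral_shift[OF meas bd]
  have "((\<lambda>t. LINT s|\<nu>. ?J t s / ?I t) \<longlongrightarrow> (LINT s|\<nu>. 1)) at_top"
  \<comment> \<open>Once \<open>?I t \<ge> 1\<close>, the shifted integral lies between 0 and
    \<open>\<bar>B\<bar> + ?I t\<close>, hence below \<open>(\<bar>B\<bar> + 1) * ?I t\<close>,
    uniformly in \<open>s\<close>.\<close>
  proof (rule integral_dominated_convergence_at_top[where w = "\<lambda>_. \<bar>B\<bar> + 1"])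
    show "(\<lambda>s. ?J t s / ?I t) \<in> borel_measurable \<nu>" for t using measJ by measurable
    show "AE s in \<nu>. ((\<lambda>t. ?J t s / ?I t) \<longlongrightarrow> 1) at_top"
    proof (rule AE_I2)
      fix s assume s: "s \<in> space \<nu>"
      have ev: "\<forall>\<^sub>F t in at_top. 0 < ?I t \<and> 0 \<le> t" 
        using lim eventually_ge_at_top[of 0] by (auto simp: filterlim_at_top_dense eventually_conj_iff)
      show "((\<lambda>t. ?J t s / ?I t) \<longlongrightarrow> 1) at_top"
      proof (rule tendsto_sandwich)
        show "\<forall>\<^sub>F t in at_top. 1 - K * s / ?I t \<le> ?J t s / ?I t"
          using ev
        proof eventually_elim
          case (elim t)
          have "1 - K * s / ?I t = (?I t - K * s) / ?I t" using elim by (simp add: diff_divide_distrib)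
          also have "\<dots> \<le> ?J t s / ?I t"
            using elim integral_shift_le(2)[OF meas bd nn delay_nonneg[OF s], of t] by (intro divide_right_mono) auto
          finally show ?case .
        qed
        show "\<forall>\<^sub>F t in at_top. ?J t s / ?I t \<le> B / ?I t + 1"
          using ev
        proof eventually_elim
          case (elim t)
          have "?J t s / ?I t \<le> (B + ?I t) / ?I t"
            using elim integral_shift_le(1)[OF meas bd nn delay_nonneg[OF s], of t] B[OF s]
            by (intro divide_right_mono) auto
          also have "\<dots> = B / ?I t + 1" using elim by (simp add: add_divide_distrib)
          finally show ?case .
        qed
        have "((\<lambda>t. 1 - K * s / ?I t) \<longlongrightarrow> 1 - 0) at_top"
          by (intro tendsto_intros real_tendsto_divide_at_top[OF tendsto_const lim])
        thus "((\<lambda>t. 1 - K * s / ?I t) \<longlongrightarrow> 1) at_top" by simp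
        have "((\<lambda>t. B / ?I t + 1) \<longlongrightarrow> 0 + 1) at_top"
          by (intro tendsto_intros real_tendsto_divide_at_top[OF tendsto_const lim])
        thus "((\<lambda>t. B / ?I t + 1) \<longlongrightarrow> 1) at_top" by simp
      qed
    qed
    show "\<forall>\<^sub>F t in at_top. AE s in \<nu>. norm (?J t s / ?I t) \<le> \<bar>B\<bar> + 1"
    proof -
      have "\<forall>\<^sub>F t in at_top. 1 \<le> ?I t \<and> 0 \<le> t"
        using lim eventually_ge_at_top[of 0] by (auto simp: filterlim_at_top eventually_conj_iff)
      thus ?thesis
      proof eventually_elim
        case (elim t)
        show ?case
        proof (rule AE_I2)
          fix s assume s: "s \<in> space \<nu>"
          have "0 \<le> ?J t s" using nn by (intro Henstock_Kurzweil_Integration.integral_nonneg bounded_borel_integrable_on[where K = K] bd) auto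
          moreover have "?J t s \<le> \<bar>B\<bar> + ?I t"
            using integral_shift_le(1)[OF meas bd nn delay_nonneg[OF s], of t] B[OF s] elim by linarith
          moreover have "\<bar>B\<bar> \<le> \<bar>B\<bar> * ?I t" using elim by (simp add: mult_le_cancel_left1)
          ultimately show "norm (?J t s / ?I t) \<le> \<bar>B\<bar> + 1"
            using elim by (simp add: divide_le_eq algebra_simps)
        qed
      qed
    qed
  qed auto
  thus ?thesis by (simp add: integral_delayed[OF meas bd])
qed

end

subsection \<open>Comparison through the primitive of the reciprocal\<close>

lemma tendsto_one_if_between_inverses:
  fixes r :: "'a \<Rightarrow> real"
  assumes "\<And>\<kappa>. \<kappa> > 1 \<Longrightarrow> \<forall>\<^sub>F t in F. 1 / \<kappa> \<le> r t \<and> r t \<le> \<kappa>"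
  shows "(r \<longlongrightarrow> 1) F"
proof (rule order_tendstoI)
  fix a :: real assume "a < 1"
  \<comment> \<open>Chosen so that \<open>1 / \<kappa>\<close> is the midpoint of
    \<open>max a 0\<close> and 1; the maximum covers negative \<open>a\<close>.\<close>
  define \<kappa> where "\<kappa> = 2 / (1 + max a 0)"
  have "\<kappa> > 1" "1 / \<kappa> > a" using \<open>a < 1\<close> by (auto simp: \<kappa>_def field_simps)
  thus "\<forall>\<^sub>F t in F. a < r t" using assms[of \<kappa>] by (auto elim!: eventually_mono)
next
  fix a :: real assume "a > 1"
  hence "(1 + a) / 2 > 1" "(1 + a) / 2 < a" by auto
  thus "\<forall>\<^sub>F t in F. r t < a" using assms[of "(1 + a) / 2"] by (auto elim!: eventually_mono)
qed

text \<open>The slope of \<open>G\<close> stays below \<open>M\<close> by the fixed margin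
  \<open>M - c\<close>, so the line \<open>M * t\<close> gains on \<open>G\<close> linearly and
  eventually makes up for any initial excess.\<close>

lemma eventually_le_linear:
  fixes G :: "real \<Rightarrow> real"
  assumes deriv: "\<And>t. t \<ge> T \<Longrightarrow> (G has_real_derivative D t) (at t)"
    and le: "\<And>t. t \<ge> T \<Longrightarrow> D t \<le> c" and "c < M"
  shows "\<forall>\<^sub>F t in at_top. G t \<le> M * t"
proof -
  have *: "G t \<le> G T + c * (t - T)" if "t \<ge> T" for t
  proof -
    have "c * T - G T \<le> c * t - G t"
    proof (rule DERIV_nonneg_imp_nondecreasing[OF that])
      fix u assume "T \<le> u" "u \<le> t"
      show "\<exists>y. ((\<lambda>t. c * t - G t) has_real_derivative y) (at u) \<and> 0 \<le> y"
        by (rule exI[of _ "c - D u"]) (use deriv[OF \<open>T \<le> u\<close>] le[OF \<open>T \<le> u\<close>] in \<open>auto intro!: derivative_eq_intros\<close>)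
    qed
    thus ?thesis by (simp add: algebra_simps)
  qed
  have "\<forall>\<^sub>F t in at_top. t \<ge> T \<and> t \<ge> (G T - c * T) / (M - c)"
    by (intro eventually_conj eventually_ge_at_top)
  thus ?thesis
  proof eventually_elim
    case (elim t)
    hence "G T - c * T \<le> (M - c) * t" using \<open>c < M\<close> by (simp add: field_simps)
    thus ?case using *[of t] elim by (simp add: algebra_simps)
  qed
qed

lemma eventually_ge_linear:
  fixes G :: "real \<Rightarrow> real"
  assumes deriv: "\<And>t. t \<ge> T \<Longrightarrow> (G has_real_derivative D t) (at t)"
    and ge: "\<And>t. t \<ge> T \<Longrightarrow> c \<le> D t" and "M < c"
  shows "\<forall>\<^sub>F t in at_top. M * t \<le> G t"
  using eventually_le_linear[of T "\<lambda>t. - G t" "\<lambda>t. - D t" "-c" "-M"] assms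
  by (auto intro!: derivative_eq_intros)

lemma recip_primitive_has_derivative:
  assumes "continuous_on {0..} f" "\<And>x. 0 \<le> x \<Longrightarrow> 0 < f x" "x > 0"
  shows "(recip_primitive f has_real_derivative 1 / f x) (at x)"
proof -
  \<comment> \<open>The interval stays inside the positive axis, contains the base point 1 and has
    \<open>x\<close> in its interior, so the one-interval derivative is a full derivative at
    \<open>x\<close>.\<close>
  define a b where "a = min x 1 / 2" and "b = max x 1 + 1"
  have ab: "0 < a" "a < x" "x < b" "a \<le> 1" "1 \<le> b" using assms(3) by (auto simp: a_def b_def)
  have "continuous_on {a..b} (\<lambda>u. 1 / f u)"
  proof (intro continuous_intros)
    show "continuous_on {a..b} f" using ab by (intro continuous_on_subset[OF assms(1)]) auto
    show "\<forall>u\<in>{a..b}. f u \<noteq> 0" using ab assms(2) by (metis atLeastAtMost_iff less_irrefl less_le_trans less_imp_le)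
  qed
  from interval_integral_FTC2[OF ab(4,5) this, of x] ab
  have "((\<lambda>u. LBINT y=ereal 1..ereal u. 1 / f y) has_vector_derivative 1 / f x) (at x within {a..b})" 
    by (simp add: one_ereal_def)
  thus ?thesis
    using ab by (simp add: recip_primitive_def[abs_def] has_real_derivative_iff_has_vector_derivative at_within_Icc_at)
qed

lemma recip_primitive_strict_mono:
  assumes "continuous_on {0..} f" "\<And>x. 0 \<le> x \<Longrightarrow> 0 < f x" "0 < x" "x < y"
  shows "recip_primitive f x < recip_primitive f y"
proof (rule DERIV_pos_imp_increasing[OF assms(4)])
  fix u assume "x \<le> u" "u \<le> y"
  thus "\<exists>d. (recip_primitive f has_real_derivative d) (at u) \<and> 0 < d"
    using assms by (intro exI[of _ "1 / f u"] conjI recip_primitive_has_derivative) auto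
qed

text \<open>The bound on \<open>f\<close> makes the slope of the primitive at least
  \<open>1 / K\<close>, so every nonnegative level is reached. Negative levels may be missed, since
  \<open>1 / f\<close> is bounded near 0.\<close>

lemma recip_primitive_surj:
  assumes f: "continuous_on {0..} f" "\<And>x. 0 \<le> x \<Longrightarrow> 0 < f x" and bd: "\<And>x. 0 \<le> x \<Longrightarrow> f x \<le> K" and "0 \<le> y"
  shows "\<exists>x>0. recip_primitive f x = y"
proof -
  have K: "K > 0" using f(2)[of 0] bd[of 0] by simp
  have one: "recip_primitive f 1 = 0" by (simp add: recip_primitive_def)
  \<comment> \<open>With slope at least \<open>1 / K\<close> from the zero at 1, the primitive has
    reached \<open>y\<close> at this point.\<close>
  define b where "b = 1 + K * y"
  have b: "1 \<le> b" using K \<open>0 \<le> y\<close> by (simp add: b_def)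
  have "recip_primitive f 1 - 1 / K \<le> recip_primitive f b - b / K"
  proof (rule DERIV_nonneg_imp_nondecreasing[OF b])
    fix u :: real assume u: "1 \<le> u" "u \<le> b"
    have "1 / K \<le> 1 / f u" using f(2)[of u] bd[of u] u by (intro frac_le) auto
    thus "\<exists>d. ((\<lambda>x. recip_primitive f x - x / K) has_real_derivative d) (at u) \<and> 0 \<le> d"
      using u K by (intro exI[of _ "1 / f u - 1 / K"] conjI)
        (auto intro!: derivative_eq_intros recip_primitive_has_derivative f)
  qed
  hence "y \<le> recip_primitive f b" using K one by (simp add: b_def field_simps)
  moreover have "continuous_on {1..b} (recip_primitive f)"
  proof (intro continuous_at_imp_continuous_on ballI)
    fix u assume "u \<in> {1..b}"
    hence "0 < u" by simp
    from recip_primitive_has_derivative[OF f this]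
    show "isCont (recip_primitive f) u" by (rule DERIV_isCont)
  qed
  ultimately obtain x where "1 \<le> x" "recip_primitive f x = y"
    using IVT'[of "recip_primitive f" 1 y b] one b \<open>0 \<le> y\<close> by auto
  thus ?thesis by (intro exI[of _ x]) auto
qed

lemma recip_primitive_inverse:
  assumes f: "continuous_on {0..} f" "\<And>x. 0 \<le> x \<Longrightarrow> 0 < f x" and bd: "\<And>x. 0 \<le> x \<Longrightarrow> f x \<le> K" and "0 \<le> y"
  shows "0 < inv_into {0<..} (recip_primitive f) y"
    and "recip_primitive f (inv_into {0<..} (recip_primitive f) y) = y"
proof -
  have y: "y \<in> recip_primitive f ` {0<..}" using recip_primitive_surj[OF assms] by auto
  show "0 < inv_into {0<..} (recip_primitive f) y" using inv_into_into[OF y] by simp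
  show "recip_primitive f (inv_into {0<..} (recip_primitive f) y) = y" by (rule f_inv_into_f[OF y])
qed

text \<open>The half of the asymptotics free of delays. From the equation only \<open>ratio\<close>
  is kept; it confines \<open>x\<close> between multiples of \<open>M * I\<close>, and
  \<open>decr\<close> turns such bounds into bounds on \<open>f (x t)\<close>, hence on the
  derivative of \<open>M * I\<close>.\<close>

lemma asymp_inverse_recip_primitive:
  fixes f x :: "real \<Rightarrow> real" and M K :: real
  defines "Y \<equiv> \<lambda>t. inv_into {0<..} (recip_primitive f) (M * t)"
  defines "I \<equiv> \<lambda>t. integral {0..t} (\<lambda>v. f (x v))"
  assumes f: "continuous_on {0..} f" "\<And>x. 0 \<le> x \<Longrightarrow> 0 < f x" and bd: "\<And>x. 0 \<le> x \<Longrightarrow> f x \<le> K"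
    and decr: "\<And>b. b > 1 \<Longrightarrow> \<exists>X. \<forall>u v. X \<le> u \<longrightarrow> u \<le> v \<longrightarrow> f v \<le> b * f u"
    and x: "continuous_on {0..} x" "\<And>t. 0 \<le> t \<Longrightarrow> 0 \<le> x t"
    and "M > 0" and lim: "filterlim I at_top at_top"
    and ratio: "((\<lambda>t. x t / (M * I t)) \<longlongrightarrow> 1) at_top"
  shows "((\<lambda>t. x t / Y t) \<longlongrightarrow> 1) at_top"
proof -
  note Fd = recip_primitive_has_derivative[OF f]
  define z where "z t = M * I t" for t
  have zlim: "filterlim z at_top at_top"
    unfolding z_def by (rule filterlim_tendsto_pos_mult_at_top[OF tendsto_const \<open>M > 0\<close> lim])
  have cfx: "continuous_on {0..t} (\<lambda>v. f (x v))" for t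
  proof (rule continuous_on_compose2[OF f(1)])
    show "continuous_on {0..t} x" by (rule continuous_on_subset[OF x(1)]) auto
    show "x ` {0..t} \<subseteq> {0..}" by (rule image_subsetI) (simp add: x(2))
  qed
  have zd: "(z has_real_derivative M * f (x t)) (at t)" if "t > 0" for t
  proof -
    have "(I has_real_derivative f (x t)) (at t within {0..t+1})"
      using integral_has_real_derivative[OF cfx[of "t + 1"], of t] that by (simp add: I_def)
    hence "(I has_real_derivative f (x t)) (at t)" using that at_within_Icc_at[of 0 t "t + 1"] by simp
    thus ?thesis unfolding z_def by (rule DERIV_cmult)
  qed
  have Y: "0 < Y t \<and> recip_primitive f (Y t) = M * t" if "t \<ge> 0" for t
    unfolding Y_def using recip_primitive_inverse[OF f bd, of "M * t"] that \<open>M > 0\<close> by simp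
  have Fle: "u \<le> v" if "recip_primitive f u \<le> recip_primitive f v" "0 < v" for u v
    using recip_primitive_strict_mono[OF f, of v u] that by force
  have "((\<lambda>t. z t / Y t) \<longlongrightarrow> 1) at_top"
  proof (rule tendsto_one_if_between_inverses)
    fix \<kappa> :: real assume \<kappa>: "\<kappa> > 1"
    \<comment> \<open>The square root leaves a margin: near monotonicity costs one factor
      \<open>b\<close>, rescaling by \<kappa> gains two.\<close>
    define b where "b = sqrt \<kappa>"
    have b1: "1 < b" "b * b = \<kappa>" using \<kappa> by (auto simp: b_def)
    hence b: "1 < b" "b < \<kappa>" "b * b = \<kappa>" using mult_strict_left_mono[of 1 b b] by auto
    obtain X where X: "\<And>u v. X \<le> u \<Longrightarrow> u \<le> v \<Longrightarrow> f v \<le> b * f u" using decr[OF b(1)] by blast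
    have "\<forall>\<^sub>F t in at_top. 1 / \<kappa> < x t / z t" "\<forall>\<^sub>F t in at_top. x t / z t < \<kappa>"
      using order_tendstoD[OF ratio] \<kappa> by (auto simp: z_def)
    \<comment> \<open>Both \<open>z t > 0\<close> and \<open>z t / \<kappa> \<ge> X\<close> follow,
      so \<open>X\<close> may be applied at \<open>z t / \<kappa>\<close> and at everything above
      it.\<close>
    moreover have "\<forall>\<^sub>F t in at_top. max 1 (\<kappa> * \<bar>X\<bar>) \<le> z t" using zlim unfolding filterlim_at_top by blast
    ultimately have "\<forall>\<^sub>F t in at_top. z t / \<kappa> \<le> x t \<and> x t \<le> \<kappa> * z t \<and> 0 < z t \<and> X \<le> z t / \<kappa> \<and> 0 < t"
      using eventually_gt_at_top[of 0]
    proof eventually_elim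
      case (elim t)
      have z: "0 < z t" "\<kappa> * \<bar>X\<bar> \<le> z t" using elim by auto
      have "z t / \<kappa> \<le> x t" using elim(1) z(1) by (simp add: pos_less_divide_eq)
      moreover have "x t \<le> \<kappa> * z t" using elim(2) z(1) by (simp add: pos_divide_less_eq)
      moreover have "\<bar>X\<bar> \<le> z t / \<kappa>" using z(2) \<kappa> by (simp add: pos_le_divide_eq mult.commute)
      ultimately show ?case using z(1) elim by simp
    qed
    then obtain T where T: "\<And>t. t \<ge> T \<Longrightarrow> z t / \<kappa> \<le> x t \<and> x t \<le> \<kappa> * z t \<and> 0 < z t \<and> X \<le> z t / \<kappa> \<and> 0 < t"
      unfolding eventually_at_top_linorder by blast
    have "\<forall>\<^sub>F t in at_top. recip_primitive f (z t / \<kappa>) \<le> M * t"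
    proof (rule eventually_le_linear)
      fix t assume t: "T \<le> t"
      show "((\<lambda>t. recip_primitive f (z t / \<kappa>)) has_real_derivative (1 / f (z t / \<kappa>)) * (M * f (x t) / \<kappa>)) (at t)"
        using T[OF t] \<kappa> by (intro DERIV_chain2[OF Fd] DERIV_cdivide zd) auto
      \<comment> \<open>Since \<open>z t / \<kappa> \<le> x t\<close>, near monotonicity bounds the
        slope by \<open>M * b / \<kappa>\<close>, which is \<open>M / b\<close>.\<close>
      have "f (x t) \<le> b * f (z t / \<kappa>)" "0 < f (z t / \<kappa>)" using T[OF t] \<kappa> by (auto intro!: X f)
      thus "(1 / f (z t / \<kappa>)) * (M * f (x t) / \<kappa>) \<le> M * b / \<kappa>"
        using \<kappa> \<open>M > 0\<close> by (simp add: pos_divide_le_eq divide_right_mono mult_ac)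
    next
      show "M * b / \<kappa> < M" using b \<kappa> \<open>M > 0\<close> by (simp add: pos_divide_less_eq)
    qed
    moreover have "\<forall>\<^sub>F t in at_top. M * t \<le> recip_primitive f (\<kappa> * z t)"
    proof (rule eventually_ge_linear)
      fix t assume t: "T \<le> t"
      show "((\<lambda>t. recip_primitive f (\<kappa> * z t)) has_real_derivative (1 / f (\<kappa> * z t)) * (\<kappa> * (M * f (x t)))) (at t)"
        using T[OF t] \<kappa> by (intro DERIV_chain2[OF Fd] DERIV_cmult zd) auto
      \<comment> \<open>Now \<open>x t \<le> \<kappa> * z t\<close> is used in the same way: the
        slope is at least \<open>M * \<kappa> / b\<close>, which is \<open>M * b\<close>.\<close>
      have "f (\<kappa> * z t) \<le> b * f (x t)" "0 < f (\<kappa> * z t)" using T[OF t] \<kappa> by (auto intro!: X f)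
      hence "b * (M * f (\<kappa> * z t)) \<le> b * (M * (b * f (x t)))" using b \<open>M > 0\<close> by simp
      hence "M * b * f (\<kappa> * z t) \<le> \<kappa> * (M * f (x t))" by (simp add: b(3)[symmetric] mult_ac)
      thus "M * b \<le> (1 / f (\<kappa> * z t)) * (\<kappa> * (M * f (x t)))"
        using \<open>0 < f (\<kappa> * z t)\<close> by (simp add: pos_le_divide_eq)
    next
      show "M < M * b" using b \<open>M > 0\<close> by simp
    qed
    moreover have "\<forall>\<^sub>F t in at_top. t \<ge> T" by (rule eventually_ge_at_top)
    ultimately show "\<forall>\<^sub>F t in at_top. 1 / \<kappa> \<le> z t / Y t \<and> z t / Y t \<le> \<kappa>"
    proof eventually_elim
      case (elim t)
      have t: "0 < z t" "0 \<le> t" using T[of t] elim(3) by auto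
      have "z t / \<kappa> \<le> Y t" by (rule Fle) (use elim(1) Y[OF t(2)] in auto)
      moreover have "Y t \<le> \<kappa> * z t"
      proof (rule Fle)
        show "recip_primitive f (Y t) \<le> recip_primitive f (\<kappa> * z t)" using elim(2) Y[OF t(2)] by simp
        show "0 < \<kappa> * z t" using t(1) \<kappa> by simp
      qed
      moreover have "0 < Y t" using Y[OF t(2)] by simp
      ultimately show ?case using \<kappa> by (simp add: pos_le_divide_eq pos_divide_le_eq mult.commute)
    qed
  qed
  hence "((\<lambda>t. x t / z t * (z t / Y t)) \<longlongrightarrow> 1 * 1) at_top"
    using ratio by (intro tendsto_mult) (auto simp: z_def)
  moreover have "\<forall>\<^sub>F t in at_top. x t / z t * (z t / Y t) = x t / Y t"
    using zlim[unfolded filterlim_at_top, rule_format, of 1] by eventually_elim auto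
  ultimately have "((\<lambda>t. x t / Y t) \<longlongrightarrow> 1 * 1) at_top" by (rule Lim_transform_eventually)
  thus ?thesis by simp
qed

subsection \<open>The integral equation\<close>

text \<open>With \<open>cut\<close>, the integral over \<open>s \<in> {0..u}\<close> becomes one over the whole space of the measure.\<close>
definition cut :: "(real \<Rightarrow> real) \<Rightarrow> real \<Rightarrow> real" where
  "cut g v = (if 0 \<le> v then g v else 0)"

text \<open>Nonlinearity and history live on the whole line, so that no domain conditions accompany
  the iteration. Lipschitz constants are asked for on half-lines below \<open>R\<close> because the
  a priori control of the iterates is an upper bound.\<close>

locale delay_problem =
  N1: delay_measure \<nu>1 + N2: delay_measure \<nu>2 for \<nu>1 \<nu>2 :: "real measure" +
  fixes f p :: "real \<Rightarrow> real" and K \<Psi> :: real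
  assumes f_cont: "continuous_on UNIV f" and f_pos: "0 < f y" and f_le: "f y \<le> K"
    and f_lip: "\<exists>L>0. \<forall>y z. y \<le> R \<longrightarrow> z \<le> R \<longrightarrow> \<bar>f y - f z\<bar> \<le> L * \<bar>y - z\<bar>"
    and p_cont: "continuous_on UNIV p" and p_le: "p t \<le> \<Psi>"
    and mass_pos: "0 < N1.mass + N2.mass"
begin

definition mass :: real where "mass = N1.mass + N2.mass"

definition rhs :: "(real \<Rightarrow> real) \<Rightarrow> real \<Rightarrow> real" where
  "rhs x u = N1.delayed (\<lambda>v. f (x v)) u + N2.delayed (cut (\<lambda>v. f (x v))) u"

definition picard :: "(real \<Rightarrow> real) \<Rightarrow> real \<Rightarrow> real" where
  "picard x t = (if t \<le> 0 then p t else p 0 + integral {0..t} (rhs x))"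

lemma K_pos: "0 < K"
  using f_pos[of 0] f_le[of 0] by simp

lemma mass_gt_0: "0 < mass"
  using mass_pos by (simp add: mass_def)

lemma f_abs_le: "\<bar>f y\<bar> \<le> K" "\<bar>cut (\<lambda>v. f (x v)) u\<bar> \<le> K"
  using f_pos[of y] f_le[of y] f_pos[of "x u"] f_le[of "x u"] K_pos by (auto simp: cut_def)

context
  fixes x :: "real \<Rightarrow> real"
  assumes x_cont: "continuous_on UNIV x"
begin

lemma f_comp_cont: "continuous_on UNIV (\<lambda>v. f (x v))"
  using continuous_on_compose2[OF f_cont x_cont] by simp

lemma f_comp_borel [measurable]: "(\<lambda>v. f (x v)) \<in> borel_measurable borel"
  using f_comp_cont by (rule borel_measurable_continuous_onI)

lemma cut_borel [measurable]: "cut (\<lambda>v. f (x v)) \<in> borel_measurable borel"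
  unfolding cut_def[abs_def] by measurable

lemma rhs_borel: "rhs x \<in> borel_measurable borel"
  unfolding rhs_def[abs_def] by measurable

lemma rhs_nonneg: "0 \<le> rhs x u"
  unfolding rhs_def
  by (intro add_nonneg_nonneg N1.delayed_nonneg N2.delayed_nonneg) (auto simp: cut_def f_pos less_imp_le)

lemma rhs_le: "rhs x u \<le> K * mass"
  using N1.abs_delayed_le[OF f_comp_borel f_abs_le(1), of u] N2.abs_delayed_le[OF cut_borel f_abs_le(2), of u]
  unfolding rhs_def mass_def by (simp add: distrib_left)

lemma rhs_abs_le: "\<bar>rhs x u\<bar> \<le> K * mass"
  using rhs_nonneg rhs_le by simp

lemma rhs_integrable: "rhs x integrable_on {a..b}"
  by (rule bounded_borel_integrable_on[OF rhs_borel rhs_abs_le])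

lemma rhs_integral_diff:
  assumes "0 \<le> a" "a \<le> b"
  shows "integral {0..b} (rhs x) - integral {0..a} (rhs x) \<in> {0..K * mass * (b - a)}"
proof -
  have "integral {0..b} (rhs x) = integral {0..a} (rhs x) + integral {a..b} (rhs x)"
    using assms by (intro Henstock_Kurzweil_Integration.integral_combine[symmetric] rhs_integrable) auto
  moreover have "0 \<le> integral {a..b} (rhs x)"
    by (intro Henstock_Kurzweil_Integration.integral_nonneg rhs_integrable) (simp add: rhs_nonneg)
  moreover have "\<bar>integral {a..b} (rhs x)\<bar> \<le> K * mass * (b - a)"
    by (rule abs_integral_le_bound[OF assms(2) rhs_borel rhs_abs_le])
  ultimately show ?thesis by auto
qed

lemma rhs_integral_lipschitz: "(K * mass)-lipschitz_on {0..} (\<lambda>t. integral {0..t} (rhs x))"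
proof (rule lipschitz_onI)
  fix a b :: real assume "a \<in> {0..}" "b \<in> {0..}"
  thus "dist (integral {0..a} (rhs x)) (integral {0..b} (rhs x)) \<le> K * mass * dist a b"
    using rhs_integral_diff[of a b] rhs_integral_diff[of b a] unfolding dist_real_def
    by (cases "a \<le> b") auto
qed (use K_pos mass_gt_0 in simp)

text \<open>Without the case split, continuity at 0 follows by composition.\<close>

lemma picard_eq: "picard x t = p (min t 0) + integral {0..max t 0} (rhs x)"
  by (auto simp: picard_def min_def max_def)

lemma picard_cont: "continuous_on UNIV (picard x)"
proof -
  have "continuous_on UNIV (\<lambda>t. p (min t 0) + integral {0..max t 0} (rhs x))"
  proof (intro continuous_on_add)
    show "continuous_on UNIV (\<lambda>t. p (min t 0))"
      by (rule continuous_on_compose2[OF p_cont]) (auto intro!: continuous_intros)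
    show "continuous_on UNIV (\<lambda>t. integral {0..max t 0} (rhs x))"
      by (rule continuous_on_compose2[OF lipschitz_on_continuous_on[OF rhs_integral_lipschitz]])
        (auto intro!: continuous_intros)
  qed
  thus ?thesis by (simp add: picard_eq[abs_def])
qed

lemma picard_bounds:
  assumes "0 \<le> t" shows "p 0 \<le> picard x t" "picard x t \<le> p 0 + K * mass * t"
  using rhs_integral_diff[of 0 t] assms by (auto simp: picard_eq)

text \<open>The bound does not depend on \<open>x\<close>. It confines all iterates and all fixed
  points up to a given time to one half-line, where one Lipschitz constant serves.\<close>

lemma picard_le: "picard x t \<le> \<Psi> + K * mass * max 0 t"
  using picard_bounds(2)[of t] p_le[of t] p_le[of 0] by (cases "t \<le> 0") (auto simp: picard_def)

text \<open>Truncation introduces a jump at 0 only, which \<open>delayed_isCont_countable\<close>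
  tolerates; two countable exceptional sets remain.\<close>

lemma rhs_isCont_countable: "countable {u. \<not> isCont (rhs x) u}"
proof -
  have c: "isCont (\<lambda>v. f (x v)) v" for v
    using f_comp_cont by (simp add: continuous_on_eq_continuous_at)
  have "isCont (cut (\<lambda>v. f (x v))) v" if "v \<noteq> 0" for v
  proof (cases "v > 0")
    case True
    have "\<forall>\<^sub>F u in nhds v. u \<in> {0<..}" by (rule eventually_nhds_in_open) (use True in auto)
    hence "\<forall>\<^sub>F u in nhds v. cut (\<lambda>v. f (x v)) u = f (x u)" by eventually_elim (simp add: cut_def)
    thus ?thesis using c[of v] by (simp add: isCont_cong)
  next
    case False
    have "\<forall>\<^sub>F u in nhds v. u \<in> {..<0}" by (rule eventually_nhds_in_open) (use False that in auto)
    hence "\<forall>\<^sub>F u in nhds v. cut (\<lambda>v. f (x v)) u = 0" by eventually_elim (simp add: cut_def)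
    thus ?thesis by (simp add: isCont_cong)
  qed
  hence "countable ({u. \<not> isCont (N1.delayed (\<lambda>v. f (x v))) u} \<union> {u. \<not> isCont (N2.delayed (cut (\<lambda>v. f (x v)))) u})"
    using c by (intro countable_Un N1.delayed_isCont_countable[where K = K] N2.delayed_isCont_countable[where K = K]
        f_comp_borel cut_borel f_abs_le)
  moreover have "{u. \<not> isCont (rhs x) u} \<subseteq> {u. \<not> isCont (N1.delayed (\<lambda>v. f (x v))) u} \<union> {u. \<not> isCont (N2.delayed (cut (\<lambda>v. f (x v)))) u}"
    unfolding rhs_def[abs_def] by (auto intro: continuous_add)
  ultimately show ?thesis by (rule countable_subset[rotated])
qed

text \<open>The fundamental theorem holds at continuity points of the integrand, and a countable set
  of other points is null.\<close>

lemma rhs_integral_has_derivative_AE: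
  "AE t in lborel. t > 0 \<longrightarrow> ((\<lambda>t. integral {0..t} (rhs x)) has_real_derivative rhs x t) (at t)"
  using AE_not_in[OF countable_imp_null_set_lborel[OF rhs_isCont_countable]]
proof eventually_elim
  case (elim t)
  show ?case
  proof
    assume t: "0 < t"
    have "isCont (rhs x) t" using elim by simp
    hence "continuous (at t within ({0..t + 1} - {})) (rhs x)"
      by (rule continuous_at_imp_continuous_at_within)
    from integral_has_vector_derivative_continuous_at[OF rhs_integrable _ _ this]
    have "((\<lambda>t. integral {0..t} (rhs x)) has_vector_derivative rhs x t) (at t within {0..t + 1})"
      using t by simp
    thus "((\<lambda>t. integral {0..t} (rhs x)) has_real_derivative rhs x t) (at t)"
      using t at_within_Icc_at[of 0 t "t + 1"] by (simp add: has_real_derivative_iff_has_vector_derivative)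
  qed
qed

end

section \<open>Contraction in a weighted norm and uniqueness\<close>

lemma picard_contraction:
  assumes x: "continuous_on UNIV x" and y: "continuous_on UNIV y"
    and hist: "\<And>t. t \<le> 0 \<Longrightarrow> x t = y t"
    and R: "\<And>t. t \<le> T \<Longrightarrow> x t \<le> R \<and> y t \<le> R"
    and L: "0 < L" "\<And>u v. u \<le> R \<Longrightarrow> v \<le> R \<Longrightarrow> \<bar>f u - f v\<bar> \<le> L * \<bar>u - v\<bar>"
    and c: "0 \<le> c" "\<And>t. 0 \<le> t \<Longrightarrow> t \<le> T \<Longrightarrow> \<bar>x t - y t\<bar> \<le> c * exp (2 * L * mass * t)"
    and t: "0 \<le> t" "t \<le> T"
  shows "\<bar>picard x t - picard y t\<bar> \<le> c / 2 * exp (2 * L * mass * t)"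
proof -
  \<comment> \<open>Up to time \<open>u\<close> the increasing weight is largest at
    \<open>u\<close>, and in the history the two functions agree; one bound \<open>?e\<close> thus
    covers all delayed arguments.\<close>
  have diff: "\<bar>rhs x u - rhs y u\<bar> \<le> c * L * mass * exp (2 * L * mass * u)" if u: "u \<in> {0..t}" for u
  proof -
    let ?e = "L * (c * exp (2 * L * mass * u))"
    have *: "\<bar>f (x v) - f (y v)\<bar> \<le> ?e" if "v \<le> u" for v
    proof (cases "v \<le> 0")
      case True
      thus ?thesis using hist[of v] L c by simp
    next
      case False
      have "\<bar>f (x v) - f (y v)\<bar> \<le> L * \<bar>x v - y v\<bar>"
        using that u t R[of v] by (intro L(2)) auto
      also have "\<dots> \<le> L * (c * exp (2 * L * mass * v))"
        using False that u t L by (intro mult_left_mono c(2)) auto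
      also have "\<dots> \<le> ?e"
        using that L c mass_gt_0 by (intro mult_left_mono) auto
      finally show ?thesis .
    qed
    have "0 \<le> ?e" using L c by simp
    hence **: "\<bar>cut (\<lambda>v. f (x v)) v - cut (\<lambda>v. f (y v)) v\<bar> \<le> ?e" if "v \<le> u" for v
      using *[OF that] by (simp add: cut_def)
    have "\<bar>N1.delayed (\<lambda>v. f (x v)) u - N1.delayed (\<lambda>v. f (y v)) u\<bar> \<le> ?e * N1.mass"
      by (rule N1.delayed_diff_le[OF f_comp_borel[OF x] f_comp_borel[OF y] f_abs_le(1) f_abs_le(1) *])
    moreover have "\<bar>N2.delayed (cut (\<lambda>v. f (x v))) u - N2.delayed (cut (\<lambda>v. f (y v))) u\<bar> \<le> ?e * N2.mass"
      by (rule N2.delayed_diff_le[OF cut_borel[OF x] cut_borel[OF y] f_abs_le(2) f_abs_le(2) **])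
    ultimately have "\<bar>rhs x u - rhs y u\<bar> \<le> ?e * N1.mass + ?e * N2.mass"
      unfolding rhs_def by linarith
    thus ?thesis by (simp add: mass_def algebra_simps)
  qed
  \<comment> \<open>The rate \<open>2 * L * mass\<close> is twice the Lipschitz constant of the
    right-hand side, so integration of the weight produces the factor one half. The nonnegative term
    at 0 is dropped afterwards.\<close>
  have int: "((\<lambda>u. c * L * mass * exp (2 * L * mass * u)) has_integral
      (c / 2 * exp (2 * L * mass * t) - c / 2 * exp (2 * L * mass * 0))) {0..t}"
    using t by (intro fundamental_theorem_of_calculus)
      (auto intro!: derivative_eq_intros simp flip: has_real_derivative_iff_has_vector_derivative)
  have "picard x t - picard y t = integral {0..t} (\<lambda>u. rhs x u - rhs y u)"
    using t Henstock_Kurzweil_Integration.integral_diff[OF rhs_integrable[OF x, of 0 t] rhs_integrable[OF y, of 0 t]]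
    by (simp add: picard_eq[OF x] picard_eq[OF y])
  also have "norm \<dots> \<le> integral {0..t} (\<lambda>u. c * L * mass * exp (2 * L * mass * u))"
    using diff int by (intro integral_norm_bound_integral integrable_diff rhs_integrable x y) auto
  also have "\<dots> \<le> c / 2 * exp (2 * L * mass * t)"
    using integral_unique[OF int] c by simp
  finally show ?thesis by simp
qed

lemma lipschitz_up_to:
  obtains L where "0 < L" "\<And>u v. u \<le> R \<Longrightarrow> v \<le> R \<Longrightarrow> \<bar>f u - f v\<bar> \<le> L * \<bar>u - v\<bar>"
  using f_lip[of R] by blast

lemma picard_fixed_point_unique:
  assumes x: "continuous_on UNIV x" "picard x = x" and y: "continuous_on UNIV y" "picard y = y"
  shows "x = y"
proof
  fix T
  show "x T = y T"
  proof (cases "T \<le> 0")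
    case True
    thus ?thesis using fun_cong[OF x(2), of T] fun_cong[OF y(2), of T] by (simp add: picard_def)
  next
    case False
    define R where "R = \<Psi> + K * mass * T"
    have R: "x t \<le> R \<and> y t \<le> R" if "t \<le> T" for t
    proof -
      have "K * mass * max 0 t \<le> K * mass * T"
        using that False K_pos mass_gt_0 by (intro mult_left_mono) auto
      thus ?thesis using picard_le[OF x(1), of t] picard_le[OF y(1), of t] x(2) y(2) by (simp add: R_def)
    qed
    obtain L where L: "0 < L" "\<And>u v. u \<le> R \<Longrightarrow> v \<le> R \<Longrightarrow> \<bar>f u - f v\<bar> \<le> L * \<bar>u - v\<bar>"
      using lipschitz_up_to[of R] by blast
    \<comment> \<open>Both fixed points lie between \<open>p 0\<close> and
      \<open>p 0 + K * mass * t\<close>, so \<open>c\<close> bounds their distance and starts the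
      induction.\<close>
    define c where "c = K * mass * T"
    have c: "0 \<le> c" using False K_pos mass_gt_0 by (simp add: c_def)
    have hist: "x t = y t" if "t \<le> 0" for t
      using that fun_cong[OF x(2), of t] fun_cong[OF y(2), of t] by (simp add: picard_def)
    have *: "\<bar>x t - y t\<bar> \<le> c / 2 ^ n * exp (2 * L * mass * t)" if "0 \<le> t" "t \<le> T" for t n
      using that
    proof (induction n arbitrary: t)
      case 0
      have "\<bar>x t - y t\<bar> \<le> K * mass * t"
        using picard_bounds[OF x(1) 0(1)] picard_bounds[OF y(1) 0(1)] x(2) y(2) by simp
      also have "\<dots> \<le> c * 1" using 0 K_pos mass_gt_0 by (simp add: c_def)
      also have "\<dots> \<le> c * exp (2 * L * mass * t)"
        using 0 L c mass_gt_0 by (intro mult_left_mono) auto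
      finally show ?case by simp
    next
      case (Suc n)
      have "\<bar>picard x t - picard y t\<bar> \<le> c / 2 ^ n / 2 * exp (2 * L * mass * t)"
        using c by (intro picard_contraction[OF x(1) y(1) hist R L _ Suc.IH Suc.prems]) auto
      thus ?case using x(2) y(2) by (simp add: mult.commute)
    qed
    have "(\<lambda>n. c * exp (2 * L * mass * T) * (1 / 2) ^ n) \<longlonglongrightarrow> c * exp (2 * L * mass * T) * 0"
      by (intro tendsto_intros LIMSEQ_power_zero) simp
    hence "\<bar>x T - y T\<bar> \<le> c * exp (2 * L * mass * T) * 0"
      using *[of T] False by (intro LIMSEQ_le_const) (auto simp: power_divide)
    thus ?thesis by simp
  qed
qed

section \<open>Existence by successive approximation\<close>

definition iter :: "nat \<Rightarrow> real \<Rightarrow> real" where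
  "iter n = (picard ^^ n) (\<lambda>t. p (min t 0))"

lemma iter_Suc: "iter (Suc n) = picard (iter n)"
  by (simp add: iter_def)

lemma iter_cont: "continuous_on UNIV (iter n)"
proof (induction n)
  case 0
  show ?case unfolding iter_def
    by (simp, rule continuous_on_compose2[OF p_cont]) (auto intro!: continuous_intros)
qed (simp add: iter_Suc picard_cont)

lemma iter_hist: "t \<le> 0 \<Longrightarrow> iter n t = p t"
  by (cases n) (auto simp: iter_Suc picard_def, simp add: iter_def)

lemma iter_le: "iter n t \<le> \<Psi> + K * mass * max 0 t"
proof (cases n)
  case 0
  thus ?thesis using p_le[of "min t 0"] K_pos mass_gt_0 by (simp add: iter_def add_increasing2)
qed (simp add: iter_Suc picard_le iter_cont)

text \<open>Each application of the contraction halves the weighted distance of consecutive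
  iterates, while at negative times all of them equal \<open>p\<close>. Replacing the weight by its
  value at \<open>T\<close> gives a geometric bound uniform in \<open>t\<close>.\<close>

lemma iter_step:
  fixes T :: real
  assumes "0 \<le> T"
  obtains C where "\<And>n t. t \<le> T \<Longrightarrow> \<bar>iter (Suc n) t - iter n t\<bar> \<le> C * (1 / 2) ^ n"
proof -
  define R where "R = \<Psi> + K * mass * T"
  have R: "iter n t \<le> R" if "t \<le> T" for t n
  proof -
    have "K * mass * max 0 t \<le> K * mass * T"
      using that assms K_pos mass_gt_0 by (intro mult_left_mono) auto
    thus ?thesis using iter_le[of n t] by (simp add: R_def)
  qed
  obtain L where L: "0 < L" "\<And>u v. u \<le> R \<Longrightarrow> v \<le> R \<Longrightarrow> \<bar>f u - f v\<bar> \<le> L * \<bar>u - v\<bar>"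
    using lipschitz_up_to[of R] by blast
  define c where "c = K * mass * T"
  have c: "0 \<le> c" using assms K_pos mass_gt_0 by (simp add: c_def)
  have *: "\<bar>iter (Suc n) t - iter n t\<bar> \<le> c / 2 ^ n * exp (2 * L * mass * t)" if "0 \<le> t" "t \<le> T" for t n
    using that
  proof (induction n arbitrary: t)
    case 0
    have "\<bar>iter (Suc 0) t - iter 0 t\<bar> \<le> K * mass * t"
      using picard_bounds[OF iter_cont[of 0] 0(1)] 0 by (simp add: iter_Suc) (simp add: iter_def)
    also have "\<dots> \<le> c * 1" using 0 K_pos mass_gt_0 by (simp add: c_def)
    also have "\<dots> \<le> c * exp (2 * L * mass * t)"
      using 0 L c mass_gt_0 by (intro mult_left_mono) auto
    finally show ?case by simp
  next
    case (Suc n)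
    have "\<bar>picard (iter (Suc n)) t - picard (iter n) t\<bar> \<le> c / 2 ^ n / 2 * exp (2 * L * mass * t)"
      using c by (intro picard_contraction[OF iter_cont iter_cont _ _ L _ Suc.IH Suc.prems]) (auto simp: iter_hist R)
    thus ?case by (simp add: iter_Suc mult.commute)
  qed
  show ?thesis
  proof (rule that[of "c * exp (2 * L * mass * T)"])
    fix n t assume t: "t \<le> T"
    show "\<bar>iter (Suc n) t - iter n t\<bar> \<le> c * exp (2 * L * mass * T) * (1 / 2) ^ n"
    proof (cases "t \<le> 0")
      case True
      thus ?thesis using c by (simp add: iter_hist)
    next
      case False
      have "\<bar>iter (Suc n) t - iter n t\<bar> \<le> c / 2 ^ n * exp (2 * L * mass * t)" using False t by (intro *) auto
      also have "\<dots> \<le> c / 2 ^ n * exp (2 * L * mass * T)"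
        using t L c mass_gt_0 by (intro mult_left_mono) auto
      finally show ?thesis by (simp add: power_divide)
    qed
  qed
qed

text \<open>The limit of the iterates, written as a telescoping series so that the Weierstrass test
  yields uniform convergence.\<close>

definition sol :: "real \<Rightarrow> real" where
  "sol t = iter 0 t + (\<Sum>n. iter (Suc n) t - iter n t)"

lemma iter_uniform_limit: "uniform_limit {..T} iter sol sequentially"
proof -
  have "uniform_limit {..T} (\<lambda>n t. iter 0 t + (\<Sum>i<n. iter (Suc i) t - iter i t)) sol sequentially"
    if T: "0 \<le> T" for T
  proof -
    obtain C where C: "\<And>n t. t \<le> T \<Longrightarrow> \<bar>iter (Suc n) t - iter n t\<bar> \<le> C * (1 / 2) ^ n"
      using iter_step[OF T] by blast
    show ?thesis
      unfolding sol_def[abs_def]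
    proof (intro uniform_limit_add uniform_limit_const Weierstrass_m_test)
      show "norm (iter (Suc n) t - iter n t) \<le> C * (1 / 2) ^ n" if "t \<in> {..T}" for n t
        using C that by simp
      show "summable (\<lambda>n. C * (1 / 2) ^ n)"
        by (intro summable_mult summable_geometric) simp
    qed
  qed
  hence "uniform_limit {..max T 0} (\<lambda>n t. iter 0 t + (\<Sum>i<n. iter (Suc i) t - iter i t)) sol sequentially"
    by simp
  hence "uniform_limit {..T} (\<lambda>n t. iter 0 t + (\<Sum>i<n. iter (Suc i) t - iter i t)) sol sequentially"
    by (rule uniform_limit_on_subset) auto
  moreover have "iter 0 t + (\<Sum>i<n. iter (Suc i) t - iter i t) = iter n t" for n t
    by (subst sum_lessThan_telescope) simp
  ultimately show ?thesis by simp
qed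

lemma sol_cont: "continuous_on UNIV sol"
proof -
  have c: "continuous_on {..T} sol" for T
    by (rule uniform_limit_theorem[OF always_eventually iter_uniform_limit])
      (auto intro: continuous_on_subset[OF iter_cont])
  \<comment> \<open>Open half-lines are needed to pass to continuity at a point.\<close>
  have "continuous_on {..<T} sol" for T
    by (rule continuous_on_subset[OF c[of T]]) auto
  hence "isCont sol t" for t
    using continuous_on_eq_continuous_at[of "{..<t + 1}" sol] by auto
  thus ?thesis by (simp add: continuous_at_imp_continuous_on)
qed

lemma iter_tendsto_sol: "(\<lambda>n. iter n t) \<longlonglongrightarrow> sol t"
  using tendsto_uniform_limitI[OF iter_uniform_limit[of t]] by simp

text \<open>Passage to the limit in \<open>iter (Suc n) = picard (iter n)\<close>: uniform
  convergence up to \<open>T\<close> makes the contraction estimate between \<open>iter n\<close>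
  and \<open>sol\<close> arbitrarily small.\<close>

lemma picard_sol: "picard sol = sol"
proof
  fix T
  have hist: "sol t = p t" if "t \<le> 0" for t
    using LIMSEQ_unique[OF iter_tendsto_sol[of t]] that by (simp add: iter_hist)
  show "picard sol T = sol T"
  proof (cases "T \<le> 0")
    case True
    thus ?thesis by (simp add: picard_def hist)
  next
    case False
    define R where "R = \<Psi> + K * mass * T"
    have R: "iter n t \<le> R" if "t \<le> T" for t n
    proof -
      have "K * mass * max 0 t \<le> K * mass * T"
        using that False K_pos mass_gt_0 by (intro mult_left_mono) auto
      thus ?thesis using iter_le[of n t] by (simp add: R_def)
    qed
    have Rs: "sol t \<le> R" if "t \<le> T" for t
      using iter_tendsto_sol[of t] R[OF that] by (intro LIMSEQ_le_const2) auto
    obtain L where L: "0 < L" "\<And>u v. u \<le> R \<Longrightarrow> v \<le> R \<Longrightarrow> \<bar>f u - f v\<bar> \<le> L * \<bar>u - v\<bar>"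
      using lipschitz_up_to[of R] by blast
    have "(\<lambda>n. picard (iter n) T) \<longlonglongrightarrow> picard sol T"
    proof (rule metric_LIMSEQ_I)
      fix e :: real assume e: "e > 0"
      \<comment> \<open>Compensates the weight at \<open>T\<close>, so that the contraction estimate
        there is \<open>e / 2\<close>.\<close>
      define c where "c = e / exp (2 * L * mass * T)"
      have c: "0 < c" using e by (simp add: c_def)
      have "\<forall>\<^sub>F n in sequentially. \<forall>t\<in>{..T}. dist (iter n t) (sol t) < c"
        using uniform_limitD[OF iter_uniform_limit c] .
      then obtain N where N: "\<And>n t. n \<ge> N \<Longrightarrow> t \<le> T \<Longrightarrow> \<bar>iter n t - sol t\<bar> < c"
        by (auto simp: eventually_sequentially dist_real_def)
      have "dist (picard (iter n) T) (picard sol T) < e" if "n \<ge> N" for n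
      proof -
        have "\<bar>picard (iter n) T - picard sol T\<bar> \<le> c / 2 * exp (2 * L * mass * T)"
        proof (rule picard_contraction[OF iter_cont sol_cont _ _ L])
          fix t assume t: "0 \<le> t" "t \<le> T"
          have "\<bar>iter n t - sol t\<bar> \<le> c * 1" using N[OF that t(2)] by simp
          also have "\<dots> \<le> c * exp (2 * L * mass * t)"
            using t L c mass_gt_0 by (intro mult_left_mono) auto
          finally show "\<bar>iter n t - sol t\<bar> \<le> c * exp (2 * L * mass * t)" .
        qed (use c False in \<open>auto simp: R Rs hist iter_hist\<close>)
        also have "\<dots> < e" using e by (simp add: c_def)
        finally show ?thesis by (simp add: dist_real_def)
      qed
      thus "\<exists>N. \<forall>n\<ge>N. dist (picard (iter n) T) (picard sol T) < e" by blast
    qed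
    moreover have "(\<lambda>n. picard (iter n) T) \<longlonglongrightarrow> sol T"
      using LIMSEQ_Suc[OF iter_tendsto_sol[of T]] by (simp add: iter_Suc)
    ultimately show ?thesis by (rule LIMSEQ_unique)
  qed
qed

section \<open>Fixed points and the differential equation\<close>

lemma fixed_point_derivative_AE:
  assumes x: "continuous_on UNIV x" "picard x = x"
  shows "AE t in lborel. t > 0 \<longrightarrow> (x has_real_derivative rhs x t) (at t)"
  using rhs_integral_has_derivative_AE[OF x(1)]
proof eventually_elim
  case (elim t)
  show ?case
  proof
    assume t: "0 < t"
    have "((\<lambda>t. p 0 + integral {0..t} (rhs x)) has_real_derivative 0 + rhs x t) (at t)"
      using elim t by (intro DERIV_add DERIV_const) auto
    moreover have "\<forall>\<^sub>F u in nhds t. u \<in> {0<..}" by (rule eventually_nhds_in_open) (use t in auto)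
    hence "\<forall>\<^sub>F u in nhds t. x u = p 0 + integral {0..u} (rhs x)"
    proof eventually_elim
      case (elim u)
      thus ?case using fun_cong[OF x(2), of u] by (simp add: picard_def)
    qed
    ultimately show "(x has_real_derivative rhs x t) (at t)"
      using DERIV_cong_ev[of t t x "\<lambda>t. p 0 + integral {0..t} (rhs x)" "rhs x t" "rhs x t"] by simp
  qed
qed

lemma fixed_point_lipschitz:
  assumes x: "continuous_on UNIV x" "picard x = x"
  shows "(K * mass)-lipschitz_on {0..} x"
proof -
  have "x t = p 0 + integral {0..t} (rhs x)" if "0 \<le> t" for t
    using fun_cong[OF x(2), of t] picard_eq[OF x(1), of t] that by simp
  thus ?thesis
    using rhs_integral_lipschitz[OF x(1)] unfolding lipschitz_on_def by (simp add: dist_real_def)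
qed

text \<open>The difference of \<open>x\<close> and the integral of the right-hand side is absolutely
  continuous with zero derivative almost everywhere, hence constant.\<close>

lemma picard_fixed_pointI:
  assumes x: "continuous_on UNIV x" and hist: "\<And>t. t \<le> 0 \<Longrightarrow> x t = p t"
    and ac: "\<And>T. 0 \<le> T \<Longrightarrow> abs_continuous_on_interval 0 T x"
    and deriv: "AE t in lborel. t > 0 \<longrightarrow> (x has_real_derivative rhs x t) (at t)"
  shows "picard x = x"
proof
  fix T
  show "picard x T = x T"
  proof (cases "T \<le> 0")
    case True
    thus ?thesis by (simp add: picard_def hist)
  next
    case False
    let ?J = "\<lambda>t. integral {0..t} (rhs x)"
    have "x 0 - ?J 0 = x T - ?J T"
    proof (rule abs_continuous_zero_derivative_imp_eq[of 0 T "\<lambda>t. x t - ?J t"])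
      show "0 \<le> T" using False by simp
      have "abs_continuous_on_interval 0 T ?J"
        by (rule lipschitz_imp_abs_continuous[OF lipschitz_on_subset[OF rhs_integral_lipschitz[OF x]]]) auto
      thus "abs_continuous_on_interval 0 T (\<lambda>t. x t - ?J t)"
        using False by (intro abs_continuous_on_interval_diff ac) auto
      show "AE t in lborel. 0 < t \<and> t < T \<longrightarrow> ((\<lambda>t. x t - ?J t) has_real_derivative 0) (at t)"
        using deriv rhs_integral_has_derivative_AE[OF x]
      proof eventually_elim
        case (elim t)
        show ?case using DERIV_diff[of x "rhs x t" t UNIV ?J "rhs x t"] elim by auto
      qed
    qed
    thus ?thesis using False by (simp add: picard_def hist)
  qed
qed

section \<open>Growth of fixed points\<close>

lemma fixed_point_asymptotics:
  assumes x: "continuous_on UNIV x" "picard x = x" and "0 \<le> \<tau>" and \<tau>: "\<And>s. s \<in> space \<nu>1 \<Longrightarrow> s \<le> \<tau>"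
  defines "I \<equiv> \<lambda>t. integral {0..t} (\<lambda>v. f (x v))"
  shows "filterlim I at_top at_top" "((\<lambda>t. x t / (mass * I t)) \<longlongrightarrow> 1) at_top"
    "filterlim x at_top at_top"
proof -
  let ?g = "\<lambda>v. f (x v)"
  note g = f_comp_borel[OF x(1)] f_abs_le(1) less_imp_le[OF f_pos]
  note h = cut_borel[OF x(1)] f_abs_le(2)
  have h0: "0 \<le> cut ?g v" for v by (simp add: cut_def f_pos less_imp_le)
  \<comment> \<open>Delays of the first measure do reach the history, but by at most \<tau>.\<close>
  have B1: "integral {-s..0} ?g \<le> K * \<tau>" if s: "s \<in> space \<nu>1" for s
  proof -
    have "integral {-s..0} ?g \<le> K * (0 - (-s))"
      using abs_integral_le_bound[OF _ g(1,2), of "-s" 0] N1.delay_nonneg[OF s] by auto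
    also have "\<dots> \<le> K * \<tau>" using \<tau>[OF s] K_pos by simp
    finally show ?thesis .
  qed
  \<comment> \<open>Delays of the second measure may be unbounded, but truncation removes the
    history; the value at 0 is negligible.\<close>
  have B2: "integral {-s..0} (cut ?g) \<le> 0" for s
  proof -
    have "integral {-s..0} (cut ?g) = integral {-s..0} (\<lambda>_. 0)"
      by (rule integral_spike[of "{0}"]) (auto simp: cut_def)
    thus ?thesis by simp
  qed
  have cutI: "integral {0..t} (cut ?g) = I t" for t
    unfolding I_def by (rule Henstock_Kurzweil_Integration.integral_cong) (simp add: cut_def)
  have xeq: "x t = p 0 + (integral {0..t} (N1.delayed ?g) + integral {0..t} (N2.delayed (cut ?g)))" if "0 \<le> t" for t
  proof -
    have "x t = p 0 + integral {0..t} (rhs x)"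
      using fun_cong[OF x(2), of t] picard_eq[OF x(1), of t] that by simp
    also have "integral {0..t} (rhs x) = integral {0..t} (N1.delayed ?g) + integral {0..t} (N2.delayed (cut ?g))"
      unfolding rhs_def[abs_def]
      using bounded_borel_integrable_on[OF N1.borel_measurable_delayed[OF g(1)] N1.abs_delayed_le[OF g(1,2)]]
        bounded_borel_integrable_on[OF N2.borel_measurable_delayed[OF h(1)] N2.abs_delayed_le[OF h]]
      by (intro Henstock_Kurzweil_Integration.integral_add)
    finally show ?thesis .
  qed
  have gint: "?g integrable_on {a..b}" for a b
    by (rule bounded_borel_integrable_on[OF g(1,2)])
  have Imono: "I a \<le> I b" if "a \<le> b" for a b
    unfolding I_def using that by (intro integral_subset_le gint) (auto simp: f_pos less_imp_le)
  \<comment> \<open>If the increasing \<open>I\<close> were bounded, the integrated equation would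
    keep \<open>x\<close> in a compact interval. There \<open>f\<close> has a positive minimum, so
    \<open>I\<close> would grow at least linearly.\<close>
  show lim: "filterlim I at_top at_top"
  proof (rule ccontr)
    assume "\<not> ?thesis"
    then obtain C where C: "\<not> (\<forall>\<^sub>F t in at_top. C \<le> I t)" unfolding filterlim_at_top by blast
    have IC: "I t \<le> C" for t
    proof (rule ccontr)
      assume "\<not> ?thesis"
      hence "\<forall>u\<ge>t. C \<le> I u" using Imono[of t] by fastforce
      thus False using C unfolding eventually_at_top_linorder by blast
    qed
    define R where "R = p 0 + ((K * \<tau> + C) * N1.mass + C * N2.mass)"
    have xR: "x t \<in> {p 0..R}" if t: "0 \<le> t" for t
    proof -
      have "integral {0..t} (N1.delayed ?g) \<le> (K * \<tau> + I t) * N1.mass"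
        unfolding I_def by (rule N1.integral_delayed_le[OF g B1 t])
      also have "\<dots> \<le> (K * \<tau> + C) * N1.mass" using IC by (intro mult_right_mono) auto
      finally have 1: "integral {0..t} (N1.delayed ?g) \<le> (K * \<tau> + C) * N1.mass" .
      have "integral {0..t} (N2.delayed (cut ?g)) \<le> (0 + integral {0..t} (cut ?g)) * N2.mass"
        by (rule N2.integral_delayed_le[OF h h0 B2 t])
      also have "\<dots> \<le> C * N2.mass" using IC cutI by (intro mult_right_mono) auto
      finally have 2: "integral {0..t} (N2.delayed (cut ?g)) \<le> C * N2.mass" .
      have "p 0 \<le> x t" using picard_bounds(1)[OF x(1) t] x(2) by simp
      thus ?thesis using 1 2 xeq[OF t] by (simp add: R_def)
    qed
    have "\<exists>y\<in>{p 0..R}. \<forall>z\<in>{p 0..R}. f y \<le> f z"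
      using xR[of 0] by (intro continuous_attains_inf continuous_on_subset[OF f_cont]) auto
    then obtain y where y: "\<And>z. z \<in> {p 0..R} \<Longrightarrow> f y \<le> f z" by blast
    \<comment> \<open>At this time the linear lower bound for \<open>I\<close> equals
      \<open>\<bar>C\<bar> + 1\<close>, which exceeds \<open>C\<close>.\<close>
    define t where "t = (\<bar>C\<bar> + 1) / f y"
    have t: "0 \<le> t" using f_pos[of y] by (simp add: t_def)
    have "integral {0..t} (\<lambda>_. f y) \<le> I t"
      unfolding I_def using xR y by (intro integral_le gint) auto
    hence "f y * t \<le> C" using IC[of t] t by (simp add: mult.commute)
    thus False using f_pos[of y] by (simp add: t_def)
  qed
  \<comment> \<open>The integrated equation is divided by \<open>I t\<close> term by term; the two
    averaged terms tend to the two masses.\<close>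
  have "((\<lambda>t. integral {0..t} (N1.delayed ?g) / I t) \<longlongrightarrow> N1.mass) at_top"
    using lim unfolding I_def by (intro N1.integral_delayed_asymp[OF g B1])
  moreover have "((\<lambda>t. integral {0..t} (N2.delayed (cut ?g)) / I t) \<longlongrightarrow> N2.mass) at_top"
    using N2.integral_delayed_asymp[OF h h0 B2] lim unfolding cutI by (simp add: eta_contract_eq)
  moreover have "((\<lambda>t. p 0 / I t) \<longlongrightarrow> 0) at_top"
    by (rule real_tendsto_divide_at_top[OF tendsto_const lim])
  ultimately have "((\<lambda>t. p 0 / I t + (integral {0..t} (N1.delayed ?g) / I t
      + integral {0..t} (N2.delayed (cut ?g)) / I t)) \<longlongrightarrow> 0 + (N1.mass + N2.mass)) at_top"
    by (intro tendsto_add)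
  moreover have "\<forall>\<^sub>F t in at_top. p 0 / I t + (integral {0..t} (N1.delayed ?g) / I t
      + integral {0..t} (N2.delayed (cut ?g)) / I t) = x t / I t"
    using eventually_ge_at_top[of 0]
  proof eventually_elim
    case (elim t)
    show ?case unfolding xeq[OF elim] by (simp add: add_divide_distrib)
  qed
  ultimately have "((\<lambda>t. x t / I t) \<longlongrightarrow> 0 + (N1.mass + N2.mass)) at_top"
    by (rule Lim_transform_eventually)
  hence xI: "((\<lambda>t. x t / I t) \<longlongrightarrow> mass) at_top" by (simp add: mass_def)
  have "((\<lambda>t. x t / I t / mass) \<longlongrightarrow> mass / mass) at_top"
    using mass_gt_0 by (intro tendsto_divide xI tendsto_const) simp
  thus "((\<lambda>t. x t / (mass * I t)) \<longlongrightarrow> 1) at_top"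
    using mass_gt_0 by (simp add: mult.commute)
  have "filterlim (\<lambda>t. x t / I t * I t) at_top at_top"
    by (rule filterlim_tendsto_pos_mult_at_top[OF xI mass_gt_0 lim])
  moreover have "\<forall>\<^sub>F t in at_top. x t / I t * I t = x t"
    using lim[unfolded filterlim_at_top, rule_format, of 1] by eventually_elim auto
  ultimately show "filterlim x at_top at_top" by (simp cong: filterlim_cong)
qed

end

subsection \<open>The hypotheses on the nonlinearity and the measures\<close>

text \<open>Far out \<open>f\<close> lies within a factor \<open>a = sqrt b\<close> of the
  decreasing \<phi>. Going from \<open>f v\<close> to \<open>\<phi> v\<close> and from
  \<open>\<phi> u\<close> back to \<open>f u\<close> costs this factor twice.\<close>

lemma asymp_decreasing:
  fixes f \<phi> :: "real \<Rightarrow> real"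
  assumes pos: "\<And>x. 0 \<le> x \<Longrightarrow> 0 < \<phi> x" and anti: "antimono_on {0..} \<phi>"
    and lim: "((\<lambda>x. f x / \<phi> x) \<longlongrightarrow> 1) at_top" and "1 < b"
  shows "\<exists>X\<ge>0. \<forall>u v. X \<le> u \<longrightarrow> u \<le> v \<longrightarrow> f v \<le> b * f u"
proof -
  define a where "a = sqrt b"
  have a: "1 < a" "a * a = b" using \<open>1 < b\<close> by (auto simp: a_def)
  have "\<forall>\<^sub>F x in at_top. 1 / a < f x / \<phi> x" "\<forall>\<^sub>F x in at_top. f x / \<phi> x < a"
    using order_tendstoD[OF lim] a by auto
  hence "\<forall>\<^sub>F x in at_top. 1 / a < f x / \<phi> x \<and> f x / \<phi> x < a \<and> 0 \<le> x"
    using eventually_ge_at_top[of 0] by eventually_elim simp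
  then obtain X where X: "\<And>x. X \<le> x \<Longrightarrow> 1 / a < f x / \<phi> x \<and> f x / \<phi> x < a \<and> 0 \<le> x"
    unfolding eventually_at_top_linorder by blast
  have "f v \<le> b * f u" if "X \<le> u" "u \<le> v" for u v
  proof -
    have u: "0 \<le> u" "0 \<le> v" using X[of u] X[of v] that by auto
    have "f v \<le> a * \<phi> v" using X[of v] that pos[OF u(2)] by (simp add: pos_divide_less_eq less_imp_le)
    also have "\<dots> \<le> a * \<phi> u"
      using monotone_onD[OF anti, of u v] u that a by (intro mult_left_mono) auto
    also have "\<phi> u \<le> a * f u"
      using X[of u] that pos[OF u(1)] a by (simp add: field_simps less_imp_le)
    hence "a * \<phi> u \<le> b * f u" using a by (simp flip: a(2) add: mult.assoc)
    finally show ?thesis .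
  qed
  moreover have "0 \<le> X" using X[of X] by simp
  ultimately show ?thesis by blast
qed

text \<open>Compactness bounds \<open>f\<close> up to \<open>X\<close>, and the value at
  \<open>X\<close> controls everything beyond.\<close>

lemma asymp_decreasing_bounded:
  fixes f :: "real \<Rightarrow> real"
  assumes "continuous_on {0..} f"
    and "X \<ge> 0" "\<And>v. X \<le> v \<Longrightarrow> f v \<le> b * f X"
  shows "\<exists>K. \<forall>x\<ge>0. f x \<le> K"
proof -
  have "\<exists>x\<in>{0..X}. \<forall>y\<in>{0..X}. f y \<le> f x"
    using assms(2) by (intro continuous_attains_sup continuous_on_subset[OF assms(1)]) auto
  then obtain x where "\<And>y. y \<in> {0..X} \<Longrightarrow> f y \<le> f x" by blast
  hence "f y \<le> max (f x) (b * f X)" if "0 \<le> y" for y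
    using that assms(3)[of y] by (cases "y \<le> X") (auto simp: le_max_iff_disj)
  thus ?thesis by blast
qed

lemma locally_lipschitz_on_Icc:
  assumes "locally_lipschitz_on {0..} f"
  shows "\<exists>L>0. \<forall>u\<in>{0..R}. \<forall>v\<in>{0..R}. \<bar>f u - f v\<bar> \<le> L * \<bar>u - v\<bar>"
proof -
  \<comment> \<open>The notion \<open>local_lipschitz\<close> carries a time parameter, here
    confined to the single point 0, and yields one constant on a compact set.\<close>
  have "local_lipschitz {0::real} {0..R} (\<lambda>_. f)"
  proof (rule local_lipschitzI)
    fix t x :: real assume "t \<in> {0}" "x \<in> {0..R}"
    hence "x \<in> {0..}" by simp
    then obtain u L where u: "0 < u" "L-lipschitz_on (cball x u \<inter> {0..}) f"
      using assms unfolding locally_lipschitz_on_def by blast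
    have "L-lipschitz_on (cball x u \<inter> {0..R}) f" by (rule lipschitz_on_subset[OF u(2)]) auto
    thus "\<exists>u>0. \<exists>L. \<forall>t\<in>cball t u \<inter> {0}. L-lipschitz_on (cball x u \<inter> {0..R}) f"
      using u(1) by blast
  qed
  then obtain L where L: "L-lipschitz_on {0..R} f"
    using local_lipschitz_compact_implies_lipschitz[of "{0::real}" "{0..R}" "\<lambda>_. f"] by auto
  \<comment> \<open>The added 1 makes the constant strictly positive.\<close>
  have "\<bar>f u - f v\<bar> \<le> (L + 1) * \<bar>u - v\<bar>" if "u \<in> {0..R}" "v \<in> {0..R}" for u v
  proof -
    have "\<bar>f u - f v\<bar> \<le> L * \<bar>u - v\<bar>" using lipschitz_onD[OF L that] by (simp add: dist_real_def)
    also have "\<dots> \<le> (L + 1) * \<bar>u - v\<bar>" by (intro mult_right_mono) auto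
    finally show ?thesis .
  qed
  moreover have "0 < L + 1" using lipschitz_on_nonneg[OF L] by simp
  ultimately show ?thesis by blast
qed

lemma delay_measureI:
  assumes sets: "sets \<mu> = sets (restrict_space borel {0..})" and "A \<in> sets \<mu>" "emeasure \<mu> A \<noteq> \<infinity>"
  shows "delay_measure (restrict_space \<mu> A)"
proof -
  have sp: "space \<mu> = {0..}" using sets_eq_imp_space_eq[OF sets] by (simp add: space_restrict_space)
  have A: "A \<subseteq> {0..}" using sets.sets_into_space[OF assms(2)] sp by simp
  show ?thesis
  proof (intro delay_measure.intro finite_measureI delay_measure_axioms.intro)
    have "emeasure (restrict_space \<mu> A) (space (restrict_space \<mu> A)) = emeasure \<mu> A"
      using assms(2) A sp by (subst emeasure_restrict_space) (auto simp: space_restrict_space Int_absorb2)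
    thus "emeasure (restrict_space \<mu> A) (space (restrict_space \<mu> A)) \<noteq> \<infinity>" using assms(3) by simp
    have "(\<lambda>s. s) \<in> borel_measurable (restrict_space borel {0..})"
      by (intro measurable_restrict_space1) simp
    hence "(\<lambda>s. s) \<in> borel_measurable \<mu>" using measurable_cong_sets[OF sets refl] by blast
    thus "(\<lambda>s. s) \<in> borel_measurable (restrict_space \<mu> A)" by (rule measurable_restrict_space1)
    show "0 \<le> s" if "s \<in> space (restrict_space \<mu> A)" for s
      using that A by (auto simp: space_restrict_space)
  qed
qed

section \<open>Reduction of the delay equation to a problem on the whole line\<close>

theorem theorem6:
  fixes \<tau> M :: real
    and \<mu>1 \<mu>2 :: "real measure"
    and f \<phi> \<psi> :: "real \<Rightarrow> real"
  assumes "\<tau> > 0"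
    and "sets \<mu>1 = sets (restrict_space borel {0..})"
    and "sets \<mu>2 = sets (restrict_space borel {0..})"
    and "emeasure \<mu>1 {0..\<tau>} + emeasure \<mu>2 {0..} = ennreal M" and "M > 0"
    and "continuous_on {0..} f" and "\<forall>x\<ge>0. f x > 0" and "locally_lipschitz_on {0..} f"
    and "\<phi> C1_differentiable_on {0<..}" and "continuous_on {0..} \<phi>"
    and "\<forall>x\<ge>0. \<phi> x > 0" and "antimono_on {0..} \<phi>"
    and "((\<lambda>x. f x / \<phi> x) \<longlongrightarrow> 1) at_top"
    and "continuous_on {-\<tau>..0} \<psi>" and "\<forall>t\<in>{-\<tau>..0}. \<psi> t > 0"
  shows "(\<exists>x. is_solution \<tau> \<mu>1 \<mu>2 f \<psi> x) \<and>
    (\<forall>x y. is_solution \<tau> \<mu>1 \<mu>2 f \<psi> x \<and> is_solution \<tau> \<mu>1 \<mu>2 f \<psi> y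
       \<longrightarrow> (\<forall>t\<ge>-\<tau>. x t = y t)) \<and>
    (\<forall>x. is_solution \<tau> \<mu>1 \<mu>2 f \<psi> x \<longrightarrow>
       filterlim x at_top at_top \<and>
       ((\<lambda>t. x t / inv_into {0<..} (recip_primitive f) (M * t)) \<longlongrightarrow> 1) at_top)"
proof -
  note sets1 = assms(2) and sets2 = assms(3) and M_eq = assms(4) and f_lip = assms(8)
  have f: "continuous_on {0..} f" "\<And>x. 0 \<le> x \<Longrightarrow> 0 < f x" using assms(6,7) by auto
  have decr: "\<exists>X\<ge>0. \<forall>u v. X \<le> u \<longrightarrow> u \<le> v \<longrightarrow> f v \<le> b * f u" if "b > 1" for b
    using asymp_decreasing[of \<phi> f b] assms(11,12,13) that by blast
  obtain K where K: "\<And>x. 0 \<le> x \<Longrightarrow> f x \<le> K"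
    using decr[of 2] asymp_decreasing_bounded[OF f(1)] by (metis less_numeral_extra(1) one_less_numeral_iff order_refl semiring_norm(76))
  obtain \<Psi> where \<Psi>: "\<And>t. t \<in> {-\<tau>..0} \<Longrightarrow> \<psi> t \<le> \<Psi>"
  proof -
    have "\<exists>t\<in>{-\<tau>..0}. \<forall>u\<in>{-\<tau>..0}. \<psi> u \<le> \<psi> t"
      using assms(1) by (intro continuous_attains_sup assms(14)) auto
    thus ?thesis using that by blast
  qed
  define \<nu>1 where "\<nu>1 = restrict_space \<mu>1 {0..\<tau>}"
  define \<nu>2 where "\<nu>2 = restrict_space \<mu>2 {0..}"
  \<comment> \<open>All three are constant extensions: \<open>f\<close> below 0, the history beyond
    both ends of \<open>{-\<tau>..0}\<close>, a solution before \<open>-\<tau>\<close>. Continuity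
    survives, and the values that enter the equation are unchanged.\<close>
  define g where "g y = f (max 0 y)" for y
  define p where "p t = \<psi> (max (-\<tau>) (min 0 t))" for t
  define ext where "ext x t = x (max (-\<tau>) t)" for x :: "real \<Rightarrow> real" and t
  have sp: "space \<mu>1 = {0..}" "space \<mu>2 = {0..}"
    using sets_eq_imp_space_eq[OF sets1] sets_eq_imp_space_eq[OF sets2] by (auto simp: space_restrict_space)
  have in_sets: "{0..\<tau>} \<in> sets \<mu>1" "{0..} \<in> sets \<mu>2" "{0..\<tau>} \<inter> space \<mu>1 \<in> sets \<mu>1" "{0..} \<inter> space \<mu>2 \<in> sets \<mu>2"
    using sp sets1 sets2 by (auto simp: sets_restrict_space_iff Int_absorb2)
  have fin: "emeasure \<mu>1 {0..\<tau>} \<noteq> \<infinity>" "emeasure \<mu>2 {0..} \<noteq> \<infinity>"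
    using M_eq by (metis ennreal_add_eq_top ennreal_neq_top infinity_ennreal_def)+
  interpret N1: delay_measure \<nu>1 unfolding \<nu>1_def by (rule delay_measureI[OF sets1 in_sets(1) fin(1)])
  interpret N2: delay_measure \<nu>2 unfolding \<nu>2_def by (rule delay_measureI[OF sets2 in_sets(2) fin(2)])
  have mass: "N1.mass + N2.mass = M"
  proof -
    have "emeasure \<nu>1 (space \<nu>1) = emeasure \<mu>1 {0..\<tau>}" "emeasure \<nu>2 (space \<nu>2) = emeasure \<mu>2 {0..}"
      unfolding \<nu>1_def \<nu>2_def
      by (subst emeasure_restrict_space, use in_sets sp in \<open>auto simp: space_restrict_space Int_absorb2\<close>)+
    hence "ennreal (N1.mass + N2.mass) = ennreal M"
      using M_eq by (simp add: N1.emeasure_eq_measure N2.emeasure_eq_measure)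
    thus ?thesis using \<open>M > 0\<close> by (subst (asm) ennreal_inj) auto
  qed
  interpret D: delay_problem \<nu>1 \<nu>2 g p K \<Psi>
  proof (unfold_locales)
    show "continuous_on UNIV g" unfolding g_def
      by (rule continuous_on_compose2[OF f(1)]) (auto intro!: continuous_intros)
    show "continuous_on UNIV p" unfolding p_def
      by (rule continuous_on_compose2[OF assms(14)]) (use \<open>\<tau> > 0\<close> in \<open>auto intro!: continuous_intros\<close>)
    show "p t \<le> \<Psi>" for t unfolding p_def using \<open>\<tau> > 0\<close> by (intro \<Psi>) auto
    show "0 < g y" "g y \<le> K" for y by (auto simp: g_def f K)
    show "0 < N1.mass + N2.mass" using mass \<open>M > 0\<close> by simp
    show "\<exists>L>0. \<forall>y z. y \<le> R \<longrightarrow> z \<le> R \<longrightarrow> \<bar>g y - g z\<bar> \<le> L * \<bar>y - z\<bar>" for R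
    proof -
      \<comment> \<open>The clamp \<open>max 0\<close> maps the half-line below \<open>R\<close>
        into a compact interval and is itself 1-Lipschitz.\<close>
      obtain L where L: "0 < L" "\<And>u v. u \<in> {0..max 0 R} \<Longrightarrow> v \<in> {0..max 0 R} \<Longrightarrow> \<bar>f u - f v\<bar> \<le> L * \<bar>u - v\<bar>"
        using locally_lipschitz_on_Icc[OF f_lip, of "max 0 R"] by blast
      have "\<bar>g y - g z\<bar> \<le> L * \<bar>y - z\<bar>" if "y \<le> R" "z \<le> R" for y z
      proof -
        have "\<bar>g y - g z\<bar> \<le> L * \<bar>max 0 y - max 0 z\<bar>"
          unfolding g_def using that by (intro L(2)) auto
        also have "\<dots> \<le> L * \<bar>y - z\<bar>" using L(1) by (intro mult_left_mono) auto
        finally show ?thesis .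
      qed
      thus ?thesis using L(1) by blast
    qed
  qed
  have D_mass: "D.mass = M" using mass by (simp add: D.mass_def)
  \<comment> \<open>For \<open>s \<le> \<tau>\<close> the argument \<open>t - s\<close> is at least
    \<open>-\<tau>\<close>, and the values of \<open>x\<close> there are nonnegative, so the
    extensions act trivially; in the second integral the cut removes exactly the delays
    \<open>s > t\<close>.\<close>
  have rhs_eq: "D.rhs (ext x) t = (LINT s:{0..\<tau>}|\<mu>1. f (x (t - s))) + (LINT s:{0..t}|\<mu>2. f (x (t - s)))"
    if x: "\<forall>t\<ge>-\<tau>. 0 \<le> x t" and t: "t > 0" for x t
  proof -
    have "N1.delayed (\<lambda>v. g (ext x v)) t = (LINT s:{0..\<tau>}|\<mu>1. f (x (t - s)))"
      unfolding N1.delayed_def unfolding \<nu>1_def set_lebesgue_integral_def integral_restrict_space[OF in_sets(3)]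
      using x t by (intro Bochner_Integration.integral_cong) (auto simp: g_def ext_def indicator_def max_def)
    moreover have "N2.delayed (cut (\<lambda>v. g (ext x v))) t = (LINT s:{0..t}|\<mu>2. f (x (t - s)))"
      unfolding N2.delayed_def unfolding \<nu>2_def set_lebesgue_integral_def integral_restrict_space[OF in_sets(4)]
      using x t \<open>\<tau> > 0\<close> sp by (intro Bochner_Integration.integral_cong) (auto simp: g_def ext_def indicator_def max_def cut_def)
    ultimately show ?thesis by (simp add: D.rhs_def)
  qed
  have to_fixed: "continuous_on UNIV (ext x) \<and> D.picard (ext x) = ext x"
    if sol: "is_solution \<tau> \<mu>1 \<mu>2 f \<psi> x" for x
  proof -
    have x: "continuous_on {-\<tau>..} x" "\<forall>t\<ge>-\<tau>. 0 \<le> x t" "locally_abs_continuous_on {0..} x" "\<forall>t\<in>{-\<tau>..0}. x t = \<psi> t"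
      "AE t in lborel. t > 0 \<longrightarrow> (x has_real_derivative
         (LINT s:{0..\<tau>}|\<mu>1. f (x (t - s))) + (LINT s:{0..t}|\<mu>2. f (x (t - s)))) (at t)"
      using sol by (auto simp: is_solution_def)
    have cont: "continuous_on UNIV (ext x)" unfolding ext_def
      by (rule continuous_on_compose2[OF x(1)]) (auto intro!: continuous_intros)
    have "D.picard (ext x) = ext x"
    proof (rule D.picard_fixed_pointI[OF cont])
      show "ext x t = p t" if "t \<le> 0" for t
        using that x(4) \<open>\<tau> > 0\<close> by (simp add: ext_def p_def min_def)
      show "abs_continuous_on_interval 0 T (ext x)" if "0 \<le> T" for T
      proof -
        have "abs_continuous_on_interval 0 T x" using x(3) that by (auto simp: locally_abs_continuous_on_def)
        moreover have "ext x t = x t" if "0 \<le> t" for t using that \<open>\<tau> > 0\<close> by (simp add: ext_def)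
        ultimately show ?thesis by (rule abs_continuous_on_interval_cong) auto
      qed
      show "AE t in lborel. t > 0 \<longrightarrow> (ext x has_real_derivative D.rhs (ext x) t) (at t)"
        using x(5)
      proof eventually_elim
        case (elim t)
        show ?case
        proof
          assume t: "0 < t"
          \<comment> \<open>Differentiability at \<open>t > 0\<close> is local, and near
            \<open>t\<close> the extension does not alter \<open>x\<close>.\<close>
          have "\<forall>\<^sub>F u in nhds t. u \<in> {0<..}" by (rule eventually_nhds_in_open) (use t in auto)
          hence "\<forall>\<^sub>F u in nhds t. ext x u = x u" by eventually_elim (use \<open>\<tau> > 0\<close> in \<open>auto simp: ext_def\<close>)
          thus "(ext x has_real_derivative D.rhs (ext x) t) (at t)"
            using elim t rhs_eq[OF x(2) t] DERIV_cong_ev[of t t "ext x" x "D.rhs (ext x) t" "D.rhs (ext x) t"] by simp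
        qed
      qed
    qed
    with cont show ?thesis ..
  qed
  have "is_solution \<tau> \<mu>1 \<mu>2 f \<psi> D.sol"
  proof -
    note fx = D.sol_cont D.picard_sol
    have hist: "D.sol t = p t" if "t \<le> 0" for t
      using fun_cong[OF fx(2), of t] that by (simp add: D.picard_def)
    \<comment> \<open>The extended history is already constant before \<open>-\<tau>\<close>, so
      clamping the constructed fixed point does nothing.\<close>
    have ext: "ext D.sol = D.sol"
    proof
      fix t
      show "ext D.sol t = D.sol t"
        using hist[of t] hist[of "-\<tau>"] \<open>\<tau> > 0\<close> by (cases "t \<le> -\<tau>") (auto simp: ext_def p_def max_def)
    qed
    have p_pos: "0 < p t" for t
      unfolding p_def using assms(1,15) by auto
    \<comment> \<open>Positive history, then values at least \<open>p 0\<close> because the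
      right-hand side is nonnegative. This places the fixed point where \<open>g\<close> coincides
      with \<open>f\<close>.\<close>
    have nn: "\<forall>t\<ge>-\<tau>. 0 \<le> D.sol t"
    proof (intro allI impI)
      fix t
      show "0 \<le> D.sol t"
        using hist[of t] D.picard_bounds(1)[OF fx(1), of t] p_pos[of t] p_pos[of 0] fx(2) by (cases "t \<le> 0") auto
    qed
    show ?thesis
      unfolding is_solution_def
    proof (intro conjI)
      show "continuous_on {-\<tau>..} D.sol" by (rule continuous_on_subset[OF fx(1)]) simp
      show "\<forall>t\<ge>-\<tau>. 0 \<le> D.sol t" by (rule nn)
      show "locally_abs_continuous_on {0..} D.sol"
        unfolding locally_abs_continuous_on_def
        by (auto intro!: lipschitz_imp_abs_continuous lipschitz_on_subset[OF D.fixed_point_lipschitz[OF fx]])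
      show "\<forall>t\<in>{-\<tau>..0}. D.sol t = \<psi> t" using hist by (auto simp: p_def min_def max_def)
      show "AE t in lborel. t > 0 \<longrightarrow> (D.sol has_real_derivative
         (LINT s:{0..\<tau>}|\<mu>1. f (D.sol (t - s))) + (LINT s:{0..t}|\<mu>2. f (D.sol (t - s)))) (at t)"
        using D.fixed_point_derivative_AE[OF fx]
        by eventually_elim (use rhs_eq[OF nn] in \<open>simp add: ext\<close>)
    qed
  qed
  moreover have "x t = y t"
    if "is_solution \<tau> \<mu>1 \<mu>2 f \<psi> x" "is_solution \<tau> \<mu>1 \<mu>2 f \<psi> y" "-\<tau> \<le> t" for x y t
  proof -
    have "ext x = ext y"
      using D.picard_fixed_point_unique to_fixed[OF that(1)] to_fixed[OF that(2)] by blast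
    from fun_cong[OF this, of t] show ?thesis using that(3) by (simp add: ext_def)
  qed
  moreover have "filterlim x at_top at_top \<and>
       ((\<lambda>t. x t / inv_into {0<..} (recip_primitive f) (M * t)) \<longlongrightarrow> 1) at_top"
    if sol: "is_solution \<tau> \<mu>1 \<mu>2 f \<psi> x" for x
  proof -
    have fx: "continuous_on UNIV (ext x)" "D.picard (ext x) = ext x" using to_fixed[OF sol] by auto
    have nn: "0 \<le> ext x t" for t using sol by (simp add: is_solution_def ext_def)
    have "s \<le> \<tau>" if "s \<in> space \<nu>1" for s using that by (simp add: \<nu>1_def space_restrict_space)
    note asymp = D.fixed_point_asymptotics[OF fx less_imp_le[OF \<open>\<tau> > 0\<close>] this]
    have gf: "(\<lambda>v. g (ext x v)) = (\<lambda>v. f (ext x v))" using nn by (simp add: g_def)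
    have ev: "\<forall>\<^sub>F t in at_top. ext x t = x t"
      using eventually_ge_at_top[of "-\<tau>"] by eventually_elim (simp add: ext_def)
    have "((\<lambda>t. ext x t / inv_into {0<..} (recip_primitive f) (M * t)) \<longlongrightarrow> 1) at_top"
    proof (rule asymp_inverse_recip_primitive[OF f K])
      show "\<exists>X. \<forall>u v. X \<le> u \<longrightarrow> u \<le> v \<longrightarrow> f v \<le> b * f u" if "1 < b" for b using decr[OF that] by blast
      show "continuous_on {0..} (ext x)" by (rule continuous_on_subset[OF fx(1)]) simp
      show "filterlim (\<lambda>t. integral {0..t} (\<lambda>v. f (ext x v))) at_top at_top" using asymp(1) gf by simp
      show "((\<lambda>t. ext x t / (M * integral {0..t} (\<lambda>v. f (ext x v)))) \<longlongrightarrow> 1) at_top"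
        using asymp(2) gf D_mass by simp
    qed (use nn \<open>M > 0\<close> in auto)
    moreover have "\<forall>\<^sub>F t in at_top. ext x t / inv_into {0<..} (recip_primitive f) (M * t)
        = x t / inv_into {0<..} (recip_primitive f) (M * t)"
      using ev by eventually_elim simp
    ultimately have "((\<lambda>t. x t / inv_into {0<..} (recip_primitive f) (M * t)) \<longlongrightarrow> 1) at_top"
      by (rule Lim_transform_eventually)
    moreover have "filterlim x at_top at_top"
      using asymp(3) filterlim_cong[OF refl refl ev] by simp
    ultimately show ?thesis by simp
  qed
  ultimately show ?thesis by blast
qed

end
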